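(* Let $H,K$ be complex Hilbert spaces with $\dim H>1$, and let $\mathcal A \subset B(H)$, $\mathcal B \subset B(K)$ be standard operator algebras which are closed under taking adjoints. Suppose that $\phi:\mathcal A \to \mathcal B$ is a bijective transformation (not assumed to be additive or linear) satisfying $$\phi(A^* )=\phi(A)^*,\qquad \phi\big(\tfrac12(AB+BA)\big)=\tfrac12\big(\phi(A)\phi(B)+\phi(B)\phi(A)\big)$$ for every $A,B \in \mathcal A$. Then at least one of the following holds: (i) there exists a unitary operator $U: H\to K$ such that $\phi(A)=UAU^*$ for all $A\in \mathcal A$; (ii) there exists an antiunitary operator $U: H\to K$ such that $\phi(A)=UAU^*$ for all $A\in \mathcal A$; (iii) there exists a unitary operator $U: H\to K$ such that $\phi(A)=UA^*U^*$ for all $A\in \mathcal A$; (iv) there exists an antiunitary operator $U: H\to K$ such that $\phi(A)=UA^*U^*$ for all $A\in \mathcal A$.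
   Context: All linear spaces are over the complex field. For a Hilbert space $H$, $B(H)$ is the algebra of all bounded linear operators on $H$ and $F(H)$ is the ideal of all bounded linear finite rank operators. A standard operator algebra on $H$ is a subalgebra of $B(H)$ that contains $F(H)$ (it need not contain the identity and need not be closed in any topology). $A^*$ denotes the Hilbert space adjoint of $A$. An antiunitary operator $U:H\to K$ is a surjective conjugate-linear isometry; for unitary and antiunitary $U$ one has $U^*=U^{-1}$. *)

theory Defs
  imports "HOL-Analysis.Analysis"
begin

section \<open>Complex Hilbert spaces\<close>

class complex_vector = real_vector +
  fixes scaleC :: "complex \<Rightarrow> 'a \<Rightarrow> 'a"  (infixr \<open>*\<^sub>C\<close> 75)
  assumes scaleC_add_right: "c *\<^sub>C (x + y) = c *\<^sub>C x + c *\<^sub>C y"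
    and scaleC_add_left: "(c + d) *\<^sub>C x = c *\<^sub>C x + d *\<^sub>C x"
    and scaleC_scaleC: "c *\<^sub>C d *\<^sub>C x = (c * d) *\<^sub>C x"
    and scaleC_one: "1 *\<^sub>C x = x"
    and scaleR_scaleC: "r *\<^sub>R x = complex_of_real r *\<^sub>C x"

global_interpretation complex_vector: vector_space "scaleC :: complex \<Rightarrow> 'a \<Rightarrow> 'a::complex_vector"
  defines cdependent = complex_vector.dependent
    and cspan = complex_vector.span
  by unfold_locales (simp_all add: scaleC_add_right scaleC_add_left scaleC_scaleC scaleC_one)

abbreviation clinear :: "('a::complex_vector \<Rightarrow> 'b::complex_vector) \<Rightarrow> bool" where
  "clinear \<equiv> Vector_Spaces.linear scaleC scaleC"

text \<open>The inner product is linear in its first argument.\<close>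

class complex_inner = complex_vector + real_normed_vector +
  fixes cinner :: "'a \<Rightarrow> 'a \<Rightarrow> complex"
  assumes cinner_commute: "cinner x y = cnj (cinner y x)"
    and cinner_add_left: "cinner (x + y) z = cinner x z + cinner y z"
    and cinner_scaleC_left: "cinner (c *\<^sub>C x) y = c * cinner x y"
    and cinner_ge_zero: "0 \<le> Re (cinner x x)"
    and cinner_eq_zero_iff: "cinner x x = 0 \<longleftrightarrow> x = 0"
    and norm_eq_sqrt_cinner: "norm x = sqrt (Re (cinner x x))"

class complex_hilbert_space = complex_inner + complete_space

text \<open>
  The constant \<^const>\<open>vector_space.dim\<close> is 0 on infinite-dimensional spaces, so the condition
  that the dimension exceeds \<open>n\<close> (and is possibly infinite) is expressed by a basis.
\<close>

definition cdim_greater :: "'a::complex_vector itself \<Rightarrow> nat \<Rightarrow> bool" where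
  "cdim_greater _ n \<longleftrightarrow>
     (\<exists>B :: 'a set. \<not> cdependent B \<and> cspan B = UNIV \<and> (finite B \<longrightarrow> n < card B))"


section \<open>Operators\<close>

definition bounded_ops :: "('a::complex_inner \<Rightarrow> 'b::complex_inner) set" where
  "bounded_ops = {A. clinear A \<and> (\<exists>K. \<forall>x. norm (A x) \<le> norm x * K)}"

definition finite_rank_ops :: "('a::complex_inner \<Rightarrow> 'b::complex_inner) set" where
  "finite_rank_ops = {A \<in> bounded_ops. \<exists>S. finite S \<and> range A \<subseteq> cspan S}"

definition cadjoint :: "('a::complex_inner \<Rightarrow> 'b::complex_inner) \<Rightarrow> 'b \<Rightarrow> 'a" where
  "cadjoint A = (THE B. \<forall>x y. cinner (A x) y = cinner x (B y))"

text \<open>The adjoint of a conjugate-linear operator.\<close>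

definition conj_adjoint :: "('a::complex_inner \<Rightarrow> 'b::complex_inner) \<Rightarrow> 'b \<Rightarrow> 'a" where
  "conj_adjoint A = (THE B. \<forall>x y. cinner (A x) y = cnj (cinner x (B y)))"

definition unitary :: "('a::complex_inner \<Rightarrow> 'b::complex_inner) \<Rightarrow> bool" where
  "unitary U \<longleftrightarrow> clinear U \<and> (\<forall>x. norm (U x) = norm x) \<and> surj U"

definition conj_linear :: "('a::complex_vector \<Rightarrow> 'b::complex_vector) \<Rightarrow> bool" where
  "conj_linear A \<longleftrightarrow> (\<forall>x y. A (x + y) = A x + A y) \<and> (\<forall>c x. A (c *\<^sub>C x) = cnj c *\<^sub>C A x)"

definition antiunitary :: "('a::complex_inner \<Rightarrow> 'b::complex_inner) \<Rightarrow> bool" where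
  "antiunitary U \<longleftrightarrow> conj_linear U \<and> (\<forall>x. norm (U x) = norm x) \<and> surj U"

definition jordan_product ::
  "('a::complex_vector \<Rightarrow> 'a) \<Rightarrow> ('a \<Rightarrow> 'a) \<Rightarrow> 'a \<Rightarrow> 'a" where
  "jordan_product A B = (\<lambda>x. (1/2) *\<^sub>C ((A \<circ> B) x + (B \<circ> A) x))"

definition standard_operator_algebra :: "('a::complex_inner \<Rightarrow> 'a) set \<Rightarrow> bool" where
  "standard_operator_algebra \<A> \<longleftrightarrow>
     \<A> \<subseteq> bounded_ops \<and> finite_rank_ops \<subseteq> \<A> \<and>
     (\<forall>A\<in>\<A>. \<forall>B\<in>\<A>. (\<lambda>x. A x + B x) \<in> \<A>) \<and>
     (\<forall>c. \<forall>A\<in>\<A>. (\<lambda>x. c *\<^sub>C A x) \<in> \<A>) \<and>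
     (\<forall>A\<in>\<A>. \<forall>B\<in>\<A>. A \<circ> B \<in> \<A>)"


section \<open>Adjoints and inverses\<close>

lemma cinner_add_right: "cinner x (y + z) = cinner x y + cinner (x::'a::complex_inner) z"
  by (metis cinner_commute cinner_add_left complex_cnj_add)

lemma cinner_scaleC_right: "cinner x (c *\<^sub>C y) = cnj c * cinner (x::'a::complex_inner) y"
  by (metis cinner_commute cinner_scaleC_left complex_cnj_mult)

lemma cinner_self_norm: "cinner x x = complex_of_real ((norm (x::'a::complex_inner))\<^sup>2)"
proof -
  have "Im (cinner x x) = 0"
    using arg_cong[OF cinner_commute[of x x], of Im] by simp
  then show ?thesis
    using cinner_ge_zero[of x] by (simp add: complex_eq_iff norm_eq_sqrt_cinner)
qed

lemma Re_cinner_polar: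
  "2 * Re (cinner x y) = (norm (x + y))\<^sup>2 - (norm x)\<^sup>2 - (norm (y::'a::complex_inner))\<^sup>2"
proof -
  have "complex_of_real ((norm (x + y))\<^sup>2) = cinner x x + cinner x y + cnj (cinner x y) + cinner y y"
    unfolding cinner_self_norm[symmetric] cinner_add_left cinner_add_right
    using cinner_commute[of y x] by simp
  from arg_cong[OF this, of Re] show ?thesis
    by (simp add: cinner_self_norm)
qed

lemma Im_cinner_eq: "Im (cinner x y) = Re (cinner x (\<i> *\<^sub>C (y::'a::complex_inner)))"
  by (simp add: cinner_scaleC_right)

lemma cinner_ext:
  fixes y z :: "'a::complex_inner"
  assumes "\<And>x. cinner x y = cinner x z"
  shows "y = z"
proof -
  have "cinner x (y - z) = 0" for x
    using cinner_add_right[of x "y - z" z] assms[of x] by simp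
  then show ?thesis
    by (metis cinner_eq_zero_iff right_minus_eq)
qed

lemma cadjoint_eqI:
  assumes "\<And>x y. cinner (A x) y = cinner x (B y)"
  shows "cadjoint A = B"
  unfolding cadjoint_def
proof (rule the_equality)
  fix C assume C: "\<forall>x y. cinner (A x) y = cinner x (C y)"
  show "C = B"
    by (rule ext, rule cinner_ext) (metis C assms)
qed (use assms in blast)

lemma conj_adjoint_eqI:
  assumes "\<And>x y. cinner (A x) y = cnj (cinner x (B y))"
  shows "conj_adjoint A = B"
  unfolding conj_adjoint_def
proof (rule the_equality)
  fix C assume C: "\<forall>x y. cinner (A x) y = cnj (cinner x (C y))"
  show "C = B"
    by (rule ext, rule cinner_ext) (metis C assms complex_cnj_cnj)
qed (use assms in blast)

lemma Re_cinner_isometry: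
  fixes U :: "'a::complex_inner \<Rightarrow> 'b::complex_inner"
  assumes "\<And>x y. U (x + y) = U x + U y" and "\<And>x. norm (U x) = norm x"
  shows "Re (cinner (U x) (U y)) = Re (cinner x y)"
  using Re_cinner_polar[of "U x" "U y"] Re_cinner_polar[of x y]
  by (simp add: assms(1)[symmetric] assms(2))

lemma unitary_cinner:
  assumes "unitary U"
  shows "cinner (U x) (U y) = cinner x y"
proof -
  interpret Vector_Spaces.linear scaleC scaleC U
    using assms by (simp add: unitary_def)
  have Re: "Re (cinner (U x) (U y)) = Re (cinner x y)" for x y
    by (rule Re_cinner_isometry) (use assms add in \<open>auto simp: unitary_def\<close>)
  show ?thesis
    by (rule complex_eqI) (simp_all only: Re Im_cinner_eq scale[symmetric])
qed

lemma antiunitary_cinner: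
  assumes "antiunitary U"
  shows "cinner (U x) (U y) = cnj (cinner x y)"
proof -
  have Re: "Re (cinner (U x) (U y)) = Re (cinner x y)" for x y
    by (rule Re_cinner_isometry) (use assms in \<open>auto simp: antiunitary_def conj_linear_def\<close>)
  have "U ((- \<i>) *\<^sub>C y) = cnj (- \<i>) *\<^sub>C U y"
    using assms unfolding antiunitary_def conj_linear_def by blast
  then have "U ((- \<i>) *\<^sub>C y) = \<i> *\<^sub>C U y"
    by simp
  then have "Re (cinner (U x) (\<i> *\<^sub>C U y)) = Re (cinner x ((- \<i>) *\<^sub>C y))"
    by (metis Re)
  then have "Im (cinner (U x) (U y)) = - Im (cinner x y)"
    unfolding cinner_scaleC_right by simp
  then show ?thesis
    by (intro complex_eqI) (simp_all add: Re)
qed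

lemma unitary_cadjoint:
  assumes "unitary U"
  shows "bij U" and "cadjoint U = inv U"
proof -
  have surj: "surj U"
    using assms by (simp add: unitary_def)
  have "inj U"
  proof (rule injI, rule cinner_ext)
    fix x y z assume "U x = U y"
    then show "cinner z x = cinner z y"
      using unitary_cinner[OF assms, of z x] unitary_cinner[OF assms, of z y] by simp
  qed
  with surj show "bij U"
    by (simp add: bij_def)
  show "cadjoint U = inv U"
  proof (rule cadjoint_eqI)
    show "cinner (U x) y = cinner x (inv U y)" for x y
      using unitary_cinner[OF assms, of x "inv U y"] by (simp add: surj_f_inv_f[OF surj])
  qed
qed

lemma antiunitary_conj_adjoint:
  assumes "antiunitary U"
  shows "bij U" and "conj_adjoint U = inv U"
proof -
  have surj: "surj U"
    using assms by (simp add: antiunitary_def)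
  have "inj U"
  proof (rule injI, rule cinner_ext)
    fix x y z assume "U x = U y"
    then show "cinner z x = cinner z y"
      using antiunitary_cinner[OF assms, of z x] antiunitary_cinner[OF assms, of z y] by simp
  qed
  with surj show "bij U"
    by (simp add: bij_def)
  show "conj_adjoint U = inv U"
  proof (rule conj_adjoint_eqI)
    show "cinner (U x) y = cnj (cinner x (inv U y))" for x y
      using antiunitary_cinner[OF assms, of x "inv U y"] by (simp add: surj_f_inv_f[OF surj])
  qed
qed

end

theory Submission
  imports Defs
begin

text \<open>
  Write \<open>A \<circ> B\<close> for the Jordan product and \<open>x y\<^sup>*\<close> for the operator \<open>z \<mapsto> \<langle>z, y\<rangle> x\<close>; for a unit
  vector \<open>p\<close>, the operator \<open>P = p p\<^sup>*\<close> is the projection onto a line. The proof recovers the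
  linear structure from the product alone and then reads off the implementing operator from the
  images of the operators \<open>x e\<^sup>*\<close>, where \<open>e\<close> is a fixed unit vector.

  Projections are the self-adjoint idempotents, and \<open>P \<circ> Q = P\<close> and \<open>P \<circ> Q = 0\<close> express order
  and orthogonality of projections. Line projections are the minimal nonzero projections, so
  \<open>\<phi>\<close> induces an orthogonality preserving bijection between the lines of both spaces. The
  solutions of \<open>A \<circ> P = A\<close> are the multiples of \<open>P\<close>, hence \<open>\<phi> (c P)\<close> is a multiple of \<open>\<phi> P\<close>;
  comparing \<open>(c P) \<circ> Q\<close> with \<open>P \<circ> (c Q)\<close> shows that the factor does not depend on \<open>P\<close>, and this
  gives \<open>\<phi> (c A) = f c (\<phi> A)\<close> for all \<open>A\<close>, with an injective multiplicative \<open>f\<close> that commutes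
  with conjugation (lemma \<open>phi_scale\<close>).

  For orthonormal \<open>x\<close> and \<open>y\<close> the operator \<open>N = x y\<^sup>*\<close> has square zero and satisfies
  \<open>N \<circ> x x\<^sup>* = N \<circ> y y\<^sup>* = N / 2\<close>. Transported by \<open>\<phi>\<close>, these equations force its image to be a multiple of \<open>u v\<^sup>*\<close> or
  of \<open>v u\<^sup>*\<close>, where \<open>u\<close> and \<open>v\<close> span the image lines. As \<open>N \<circ> (A \<circ> N)\<close> is \<open>\<langle>A x, y\<rangle> N / 2\<close>, every
  off-diagonal matrix entry of \<open>\<phi> A\<close> is, by a factor that does not depend on \<open>A\<close>, a multiple of \<open>f\<close> applied to an off-diagonal entry
  of \<open>A\<close> (lemma \<open>coeff_entry\<close>). For \<open>A = P + t Q\<close>, with lines bisecting those of \<open>x\<close> and \<open>y\<close>,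
  this yields \<open>f (1 - t) = 1 - f t\<close>. A multiplicative function with that property is additive;
  as \<open>f\<close> also maps the reals to the reals, it fixes them and is therefore the identity or the
  conjugation on the complex numbers (lemma \<open>coeff_cases\<close>). Now the off-diagonal entries
  of \<open>\<phi> (A + B)\<close> and \<open>\<phi> A + \<phi> B\<close> agree. The same holds after multiplication by a line projection,
  which brings the diagonal entries into play, and therefore \<open>\<phi>\<close> is additive (lemma \<open>phi_add\<close>).

  The images of the operators \<open>x e\<^sup>*\<close> with \<open>x\<close> orthogonal to \<open>e\<close> are all of the form \<open>u e'\<^sup>*\<close> or all of
  the form \<open>e' u\<^sup>*\<close>. The second case turns into the first one when \<open>\<phi>\<close> is replaced by
  \<open>A \<mapsto> \<phi> (A\<^sup>*)\<close>; this is the reason why the adjoint occurs in the conclusion. In the first case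
  \<open>\<phi> (x e\<^sup>*) = (U x) e'\<^sup>*\<close> defines a map \<open>U\<close> which is linear if \<open>f\<close> is the identity and
  conjugate-linear if \<open>f\<close> is the conjugation. It is isometric and onto, and it
  implements \<open>\<phi>\<close> (lemma \<open>implemented_by_semilinear\<close>).
\<close>

section \<open>Geometry of complex inner product spaces\<close>

lemma cinner_zero_left [simp]: "cinner 0 (y::'a::complex_inner) = 0"
  using cinner_add_left[of 0 0 y] by simp

lemma cinner_zero_right [simp]: "cinner (y::'a::complex_inner) 0 = 0"
  using cinner_add_right[of y 0 0] by simp

lemma cinner_diff_left: "cinner (x - y) z = cinner x z - cinner y (z::'a::complex_inner)"
  using cinner_add_left[of "x - y" y z] by simp

lemma cinner_diff_right: "cinner z (x - y) = cinner z x - cinner z (y::'a::complex_inner)"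
  using cinner_add_right[of z "x - y" y] by simp

lemmas cinner_simps =
  cinner_add_left cinner_add_right cinner_diff_left cinner_diff_right
  cinner_scaleC_left cinner_scaleC_right

lemmas scaleC_simps =
  scaleC_add_left scaleC_add_right complex_vector.scale_left_diff_distrib
  complex_vector.scale_right_diff_distrib scaleC_scaleC

lemma cinner_self_unit: "norm (x::'a::complex_inner) = 1 \<Longrightarrow> cinner x x = 1"
  by (simp add: cinner_self_norm)

lemma unit_nonzero: "norm (x::'a::complex_inner) = 1 \<Longrightarrow> x \<noteq> 0"
  by auto

lemma cinner_zero_commute: "cinner x y = 0 \<longleftrightarrow> cinner y (x::'a::complex_inner) = 0"
  by (metis cinner_commute complex_cnj_zero)

lemma scaleC_two: "2 *\<^sub>C x = x + (x::'a::complex_vector)"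
  using scaleC_add_left[of 1 1 x] by (simp add: scaleC_one)

lemma norm_scaleC: "norm (c *\<^sub>C (x::'a::complex_inner)) = cmod c * norm x"
proof -
  have "complex_of_real ((norm (c *\<^sub>C x))\<^sup>2) = complex_of_real ((cmod c * norm x)\<^sup>2)"
    unfolding power_mult_distrib of_real_mult complex_norm_square cinner_self_norm[symmetric]
    by (simp add: cinner_simps)
  then have "(norm (c *\<^sub>C x))\<^sup>2 = (cmod c * norm x)\<^sup>2"
    using of_real_eq_iff by blast
  then show ?thesis
    by (rule power2_eq_imp_eq) auto
qed

lemma unit_scale:
  fixes x :: "'a::complex_inner"
  assumes "x \<noteq> 0"
  shows "norm (complex_of_real (1 / norm x) *\<^sub>C x) = 1"
    and "x = complex_of_real (norm x) *\<^sub>C (complex_of_real (1 / norm x) *\<^sub>C x)"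
proof -
  show "norm (complex_of_real (1 / norm x) *\<^sub>C x) = 1"
    using assms by (simp add: norm_scaleC norm_divide)
  show "x = complex_of_real (norm x) *\<^sub>C (complex_of_real (1 / norm x) *\<^sub>C x)"
    using assms by (simp add: scaleC_scaleC scaleC_one)
qed

lemma parallelogram:
  fixes x y :: "'a::complex_inner"
  shows "(norm (x + y))\<^sup>2 + (norm (x - y))\<^sup>2 = 2 * (norm x)\<^sup>2 + 2 * (norm y)\<^sup>2"
proof -
  have "cinner (x + y) (x + y) + cinner (x - y) (x - y) = 2 * cinner x x + 2 * cinner y y"
    by (simp add: cinner_simps)
  then have "complex_of_real ((norm (x + y))\<^sup>2 + (norm (x - y))\<^sup>2)
      = complex_of_real (2 * (norm x)\<^sup>2 + 2 * (norm y)\<^sup>2)"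
    by (simp add: cinner_self_norm)
  then show ?thesis
    using of_real_eq_iff by blast
qed

lemma norm_square_scaleC_diff:
  fixes x y :: "'a::complex_inner"
  shows "complex_of_real ((norm (x - c *\<^sub>C y))\<^sup>2) =
    complex_of_real ((norm x)\<^sup>2) - cnj c * cinner x y - c * cnj (cinner x y) + c * cnj c * complex_of_real ((norm y)\<^sup>2)"
  unfolding cinner_self_norm[symmetric]
  by (simp add: cinner_simps cinner_commute[of y x] algebra_simps)

lemma Cauchy_Schwarz:
  fixes x y :: "'a::complex_inner"
  shows "cmod (cinner x y) \<le> norm x * norm y"
proof (cases "y = 0")
  case False
  define c where "c = cinner x y / complex_of_real ((norm y)\<^sup>2)"
  have y: "complex_of_real ((norm y)\<^sup>2) \<noteq> 0"
    using False by simp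
  have "c * cnj c * complex_of_real ((norm y)\<^sup>2) = cnj c * cinner x y"
    using y by (simp add: c_def del: of_real_power)
  moreover have "c * cnj (cinner x y) = complex_of_real ((cmod (cinner x y))\<^sup>2 / (norm y)\<^sup>2)"
    using y by (simp add: c_def complex_norm_square[symmetric] del: of_real_power)
  ultimately have "complex_of_real ((norm (x - c *\<^sub>C y))\<^sup>2)
      = complex_of_real ((norm x)\<^sup>2 - (cmod (cinner x y))\<^sup>2 / (norm y)\<^sup>2)"
    unfolding norm_square_scaleC_diff by simp
  then have "(norm (x - c *\<^sub>C y))\<^sup>2 = (norm x)\<^sup>2 - (cmod (cinner x y))\<^sup>2 / (norm y)\<^sup>2"
    using of_real_eq_iff by blast
  then have "(cmod (cinner x y))\<^sup>2 / (norm y)\<^sup>2 \<le> (norm x)\<^sup>2"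
    using zero_le_power2[of "norm (x - c *\<^sub>C y)"] by linarith
  then have "(cmod (cinner x y))\<^sup>2 \<le> (norm x * norm y)\<^sup>2"
    using False by (simp add: field_simps)
  then show ?thesis
    by (rule power2_le_imp_le) simp
qed simp

text \<open>
  The vector of least norm on the hyperplane \<open>g = 1\<close> is orthogonal to the kernel of \<open>g\<close>, and
  is therefore a multiple of the representing vector. It exists by completeness: by the
  parallelogram law, points of the hyperplane of nearly minimal norm are close to each other.
\<close>

lemma Riesz_representation:
  fixes g :: "'a::complex_hilbert_space \<Rightarrow> complex"
  assumes add: "\<And>x y. g (x + y) = g x + g y"
    and scale: "\<And>c x. g (c *\<^sub>C x) = c * g x"
    and bound: "\<And>x. cmod (g x) \<le> norm x * K"
  shows "\<exists>y. \<forall>x. g x = cinner x y"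
proof (cases "\<forall>x. g x = 0")
  case True
  then show ?thesis
    by (intro exI[of _ 0]) simp
next
  case False
  have diff: "g (x - y) = g x - g y" for x y
    using add[of "x - y" y] by simp
  have scaleR: "g (r *\<^sub>R x) = complex_of_real r * g x" for r x
    by (simp add: scaleR_scaleC scale)
  define C where "C = {x. g x = 1}"
  from False obtain x1 where "g x1 \<noteq> 0" by blast
  then have "(1 / g x1) *\<^sub>C x1 \<in> C"
    by (simp add: C_def scale)
  then have ne: "C \<noteq> {}" by blast
  define d where "d = (INF x\<in>C. (norm x)\<^sup>2)"
  have bdd: "bdd_below ((\<lambda>x. (norm x)\<^sup>2) ` C)"
    by (rule bdd_belowI[of _ 0]) auto
  have d_le: "d \<le> (norm x)\<^sup>2" if "x \<in> C" for x
    unfolding d_def using cINF_lower[OF bdd that] .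
  have "\<exists>x\<in>C. (norm x)\<^sup>2 < d + 1 / real (Suc n)" for n
  proof -
    have "d < d + 1 / real (Suc n)" by simp
    then show ?thesis
      unfolding d_def using cINF_less_iff[OF ne bdd] by blast
  qed
  then obtain X where X: "\<And>n. X n \<in> C" "\<And>n. (norm (X n))\<^sup>2 < d + 1 / real (Suc n)"
    by metis
  \<comment> \<open>The midpoint of two points of the hyperplane lies on it again.\<close>
  have close: "(norm (x - y))\<^sup>2 \<le> 2 * (norm x)\<^sup>2 + 2 * (norm y)\<^sup>2 - 4 * d"
    if "x \<in> C" "y \<in> C" for x y
  proof -
    have "(1/2) *\<^sub>R (x + y) \<in> C"
      using that by (simp add: C_def scaleR add)
    from d_le[OF this] have "4 * d \<le> (norm (x + y))\<^sup>2"
      by (simp add: power_divide)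
    then show ?thesis
      using parallelogram[of x y] by linarith
  qed
  have "Cauchy X"
  proof (rule metric_CauchyI)
    fix e :: real assume e: "0 < e"
    obtain M where M: "4 / real (Suc M) < e\<^sup>2"
    proof -
      obtain M where "4 / e\<^sup>2 < real M"
        using reals_Archimedean2 by blast
      then have "4 / e\<^sup>2 < real (Suc M)" by simp
      then have "4 / real (Suc M) < e\<^sup>2"
        using e by (simp add: field_simps)
      then show ?thesis by (rule that)
    qed
    have "dist (X m) (X n) < e" if "m \<ge> M" "n \<ge> M" for m n
    proof -
      have "1 / real (Suc m) \<le> 1 / real (Suc M)" "1 / real (Suc n) \<le> 1 / real (Suc M)"
        using that by (auto intro!: divide_left_mono)
      then have "(norm (X m - X n))\<^sup>2 < 4 / real (Suc M)"
        using close[OF X(1)[of m] X(1)[of n]] X(2)[of m] X(2)[of n] by linarith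
      with M have "(norm (X m - X n))\<^sup>2 < e\<^sup>2" by linarith
      then show ?thesis
        unfolding dist_norm using e by (simp add: power2_less_imp_less)
    qed
    then show "\<exists>M. \<forall>m\<ge>M. \<forall>n\<ge>M. dist (X m) (X n) < e" by blast
  qed
  then obtain x0 where x0: "X \<longlonglongrightarrow> x0"
    using Cauchy_convergent convergent_def by blast
  have blin: "bounded_linear g"
    by (rule bounded_linear_intro[of _ K]) (use add scaleR bound in \<open>auto simp: scaleR_conv_of_real\<close>)
  have "(\<lambda>n. g (X n)) \<longlonglongrightarrow> g x0"
    using bounded_linear.tendsto[OF blin x0] .
  moreover have "g (X n) = 1" for n
    using X(1)[of n] by (simp add: C_def)
  ultimately have g0: "g x0 = 1"
    by (simp add: LIMSEQ_const_iff)
  have "(\<lambda>n. (norm (X n))\<^sup>2) \<longlonglongrightarrow> (norm x0)\<^sup>2"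
    by (intro tendsto_intros x0)
  moreover have "(\<lambda>n. d + 1 / real (Suc n)) \<longlonglongrightarrow> d + 0"
    by (intro tendsto_intros LIMSEQ_Suc[OF lim_1_over_n])
  ultimately have "(norm x0)\<^sup>2 \<le> d + 0"
    by (rule LIMSEQ_le) (use X(2) less_imp_le in blast)
  then have le_d: "(norm x0)\<^sup>2 \<le> d" by simp
  have orth: "cinner k x0 = 0" if k: "g k = 0" for k
  proof (cases "k = 0")
    case False
    define a where "a = cinner x0 k"
    define c where "c = a / complex_of_real ((norm k)\<^sup>2)"
    have nk: "complex_of_real ((norm k)\<^sup>2) \<noteq> 0"
      using False by simp
    have "x0 - c *\<^sub>C k \<in> C"
      by (simp add: C_def diff scale g0 k)
    from d_le[OF this] le_d have le: "(norm x0)\<^sup>2 \<le> (norm (x0 - c *\<^sub>C k))\<^sup>2" by linarith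
    have "c * cnj c * complex_of_real ((norm k)\<^sup>2) = cnj c * a"
      using nk by (simp add: c_def del: of_real_power)
    moreover have "c * cnj a = complex_of_real ((cmod a)\<^sup>2 / (norm k)\<^sup>2)"
      using nk by (simp add: c_def complex_norm_square[symmetric] del: of_real_power)
    ultimately have "complex_of_real ((norm (x0 - c *\<^sub>C k))\<^sup>2)
        = complex_of_real ((norm x0)\<^sup>2 - (cmod a)\<^sup>2 / (norm k)\<^sup>2)"
      unfolding norm_square_scaleC_diff a_def[symmetric] by simp
    then have "(norm (x0 - c *\<^sub>C k))\<^sup>2 = (norm x0)\<^sup>2 - (cmod a)\<^sup>2 / (norm k)\<^sup>2"
      using of_real_eq_iff by blast
    with le have "(cmod a)\<^sup>2 / (norm k)\<^sup>2 \<le> 0" by linarith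
    then have "a = 0"
      using False by (simp add: divide_le_0_iff)
    then show ?thesis
      by (simp add: a_def cinner_zero_commute)
  qed simp
  have "x0 \<noteq> 0"
    using g0 scale[of 0 x0] by auto
  then have n0: "complex_of_real ((norm x0)\<^sup>2) \<noteq> 0" by simp
  have "g x = cinner x (complex_of_real (1 / (norm x0)\<^sup>2) *\<^sub>C x0)" for x
  proof -
    have "cinner (x - g x *\<^sub>C x0) x0 = 0"
      by (rule orth) (simp add: diff scale g0)
    then have "cinner x x0 = g x * complex_of_real ((norm x0)\<^sup>2)"
      by (simp add: cinner_simps cinner_self_norm)
    then show ?thesis
      using n0 by (simp add: cinner_simps)
  qed
  then show ?thesis by blast
qed

section \<open>Bounded operators and rank-one operators\<close>

lemma bounded_ops_add: "A \<in> bounded_ops \<Longrightarrow> A (x + y) = A x + A y"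
  by (auto simp: bounded_ops_def Vector_Spaces.linear_iff)

lemma bounded_ops_scale: "A \<in> bounded_ops \<Longrightarrow> A (c *\<^sub>C x) = c *\<^sub>C A x"
  by (auto simp: bounded_ops_def Vector_Spaces.linear_iff)

lemma bounded_ops_diff: "A \<in> bounded_ops \<Longrightarrow> A (x - y) = A x - A y"
  using bounded_ops_add[of A "x - y" y] by simp

lemma bounded_ops_zero: "A \<in> bounded_ops \<Longrightarrow> A 0 = 0"
  using bounded_ops_add[of A 0 0] by simp

lemmas bounded_ops_simps = bounded_ops_add bounded_ops_scale bounded_ops_diff bounded_ops_zero

lemma cinner_cadjoint:
  fixes A :: "'a::complex_hilbert_space \<Rightarrow> 'b::complex_inner"
  assumes A: "A \<in> bounded_ops"
  shows "cinner (A x) y = cinner x (cadjoint A y)"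
proof -
  obtain K where K: "\<And>x. norm (A x) \<le> norm x * K"
    using A by (auto simp: bounded_ops_def)
  have "\<exists>z. \<forall>x. cinner (A x) y = cinner x z" for y
  proof (rule Riesz_representation)
    show "cmod (cinner (A x) y) \<le> norm x * (K * norm y)" for x
      using Cauchy_Schwarz[of "A x" y] mult_right_mono[OF K[of x] norm_ge_zero[of y]]
      by (simp add: mult.assoc)
  qed (simp_all add: bounded_ops_simps[OF A] cinner_simps)
  then obtain B where "\<And>x y. cinner (A x) y = cinner x (B y)"
    by metis
  then show ?thesis
    by (simp add: cadjoint_eqI)
qed

lemma cinner_cadjoint':
  fixes A :: "'a::complex_hilbert_space \<Rightarrow> 'b::complex_inner"
  assumes A: "A \<in> bounded_ops"
  shows "cinner (cadjoint A x) y = cinner x (A y)"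
  by (metis assms cinner_cadjoint cinner_commute)

lemma cadjoint_cadjoint:
  fixes A :: "'a::complex_hilbert_space \<Rightarrow> 'b::complex_inner"
  assumes "A \<in> bounded_ops"
  shows "cadjoint (cadjoint A) = A"
  by (rule cadjoint_eqI) (rule cinner_cadjoint'[OF assms])

lemma jordan_product_apply: "jordan_product A B x = (1/2) *\<^sub>C (A (B x) + B (A x))"
  by (simp add: jordan_product_def)

lemma cadjoint_jordan_product:
  fixes A B :: "'a::complex_hilbert_space \<Rightarrow> 'a"
  assumes "A \<in> bounded_ops" "B \<in> bounded_ops"
  shows "cadjoint (jordan_product A B) = jordan_product (cadjoint A) (cadjoint B)"
  by (rule cadjoint_eqI)
    (simp add: jordan_product_apply cinner_simps cinner_cadjoint assms)

definition ketbra :: "'b \<Rightarrow> 'a \<Rightarrow> 'a::complex_inner \<Rightarrow> 'b::complex_inner" where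
  "ketbra x y = (\<lambda>z. cinner z y *\<^sub>C x)"

definition scale_op :: "complex \<Rightarrow> ('a \<Rightarrow> 'b::complex_vector) \<Rightarrow> 'a \<Rightarrow> 'b" where
  "scale_op c A = (\<lambda>z. c *\<^sub>C A z)"

definition add_op :: "('a \<Rightarrow> 'b::complex_vector) \<Rightarrow> ('a \<Rightarrow> 'b) \<Rightarrow> 'a \<Rightarrow> 'b" where
  "add_op A B = (\<lambda>z. A z + B z)"

abbreviation zero_op :: "'a \<Rightarrow> 'b::complex_vector" where
  "zero_op \<equiv> \<lambda>z. 0"

lemma ketbra_apply: "ketbra x y z = cinner z y *\<^sub>C x"
  by (simp add: ketbra_def)

lemma scale_op_apply: "scale_op c A z = c *\<^sub>C A z"
  by (simp add: scale_op_def)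

lemma add_op_apply: "add_op A B z = A z + B z"
  by (simp add: add_op_def)

lemma cadjoint_ketbra: "cadjoint (ketbra x y) = ketbra y x"
  by (rule cadjoint_eqI) (simp add: ketbra_apply cinner_simps cinner_commute[of x])

lemma ketbra_finite_rank: "ketbra x y \<in> finite_rank_ops"
proof -
  have "ketbra x y \<in> bounded_ops"
    unfolding bounded_ops_def mem_Collect_eq
  proof (intro conjI exI allI)
    show "clinear (ketbra x y)"
      by (simp add: Vector_Spaces.linear_iff ketbra_apply cinner_simps scaleC_simps
          complex_vector.vector_space_axioms)
    show "norm (ketbra x y z) \<le> norm z * (norm y * norm x)" for z
      using mult_right_mono[OF Cauchy_Schwarz[of z y] norm_ge_zero[of x]]
      by (simp add: ketbra_apply norm_scaleC mult.assoc)
  qed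
  moreover have "range (ketbra x y) \<subseteq> cspan {x}"
    unfolding ketbra_def
    by (intro image_subsetI complex_vector.span_scale complex_vector.span_base) simp
  ultimately show ?thesis
    unfolding finite_rank_ops_def by blast
qed

lemma jordan_product_commute: "jordan_product A B = jordan_product B A"
  by (simp add: jordan_product_def add.commute)

lemma ketbra_scale_left: "ketbra (c *\<^sub>C x) y = scale_op c (ketbra x y)"
  by (auto simp: ketbra_apply scale_op_apply scaleC_simps mult.commute)

lemma ketbra_add_left: "ketbra (x + x') y = add_op (ketbra x y) (ketbra x' y)"
  by (auto simp: ketbra_apply add_op_apply scaleC_simps)

lemma jordan_product_eqI:
  assumes "\<And>z. A (B z) + B (A z) = 2 *\<^sub>C C z"
  shows "jordan_product A B = C"
  by (rule ext) (simp add: jordan_product_apply assms scaleC_simps scaleC_one)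

lemma jordan_product_eqD:
  assumes "jordan_product A B = C"
  shows "A (B z) + B (A z) = 2 *\<^sub>C C z"
  using fun_cong[OF assms, of z, unfolded jordan_product_apply]
  by (metis scaleC_scaleC scaleC_one nonzero_mult_div_cancel_left times_divide_eq_right
      mult.right_neutral zero_neq_numeral)

lemma jordan_product_self: "A \<in> bounded_ops \<Longrightarrow> jordan_product A A z = A (A z)"
  by (simp add: jordan_product_apply scaleC_simps scaleC_one flip: scaleC_two)

lemma jordan_product_scale_left:
  "B \<in> bounded_ops \<Longrightarrow> jordan_product (scale_op c A) B = scale_op c (jordan_product A B)"
  by (auto simp: jordan_product_apply scale_op_apply bounded_ops_simps scaleC_simps mult.commute)

lemma jordan_product_scale_right:
  "A \<in> bounded_ops \<Longrightarrow> jordan_product A (scale_op c B) = scale_op c (jordan_product A B)"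
  using jordan_product_scale_left by (metis jordan_product_commute)

lemma jordan_product_add_left:
  "B \<in> bounded_ops \<Longrightarrow>
    jordan_product (add_op A A') B = add_op (jordan_product A B) (jordan_product A' B)"
  by (auto simp: jordan_product_apply add_op_apply bounded_ops_simps scaleC_simps)

lemma jordan_product_add_right:
  "A \<in> bounded_ops \<Longrightarrow>
    jordan_product A (add_op B B') = add_op (jordan_product A B) (jordan_product A B')"
  using jordan_product_add_left by (metis jordan_product_commute)

lemma scale_op_scale_op: "scale_op c (scale_op d A) = scale_op (c * d) A"
  by (auto simp: scale_op_apply scaleC_simps)

lemma scale_op_one [simp]: "scale_op 1 A = A"
  by (auto simp: scale_op_apply scaleC_one)

lemma scale_op_cancel:
  assumes "scale_op c A = scale_op d A" "A \<noteq> zero_op"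
  shows "c = d"
proof -
  obtain z where "A z \<noteq> 0" using assms(2) by auto
  with fun_cong[OF assms(1), of z] show ?thesis
    by (simp add: scale_op_apply)
qed

lemma scale_op_zero_left [simp]: "scale_op 0 A = zero_op"
  by (auto simp: scale_op_apply)

lemma cadjoint_scale_op:
  fixes A :: "'a::complex_hilbert_space \<Rightarrow> 'b::complex_inner"
  shows "A \<in> bounded_ops \<Longrightarrow> cadjoint (scale_op c A) = scale_op (cnj c) (cadjoint A)"
  by (rule cadjoint_eqI) (simp add: scale_op_apply cinner_simps cinner_cadjoint)

lemma ketbra_bounded: "ketbra x y \<in> bounded_ops"
  using ketbra_finite_rank finite_rank_ops_def by blast

lemma ketbra_self_nonzero: "norm p = 1 \<Longrightarrow> ketbra p p \<noteq> zero_op"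
  by (auto simp: ketbra_apply fun_eq_iff cinner_self_unit intro!: exI[of _ p])

lemma ketbra_self_idem: "norm p = 1 \<Longrightarrow> jordan_product (ketbra p p) (ketbra p p) = ketbra p p"
  by (rule jordan_product_eqI) (simp add: ketbra_apply cinner_simps cinner_self_unit flip: scaleC_two)

text \<open>
  With \<open>P = p p\<^sup>*\<close>, the equation \<open>A P + P A = 2 A\<close> forces \<open>A = P A P\<close>, and \<open>P A P\<close> is a multiple of \<open>P\<close>.
\<close>

lemma jordan_unit_ketbra_self:
  fixes A :: "'a::complex_inner \<Rightarrow> 'a"
  assumes p: "norm p = 1" and A: "A \<in> bounded_ops" and eq: "jordan_product A (ketbra p p) = A"
  shows "A = scale_op (cinner (A p) p) (ketbra p p)"
proof
  fix z
  note eq' = jordan_product_eqD[OF eq, unfolded ketbra_apply bounded_ops_scale[OF A]]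
  have "A p = cinner (A p) p *\<^sub>C p"
    using eq'[of p] by (simp add: cinner_self_unit[OF p] scaleC_two scaleC_one)
  then have Ap: "A p = c *\<^sub>C p" if "c = cinner (A p) p" for c
    using that by simp
  have "cinner (cinner z p *\<^sub>C A p + cinner (A z) p *\<^sub>C p) p = cinner (2 *\<^sub>C A z) p"
    by (simp only: eq')
  then have "cinner (A z) p = cinner z p * cinner (A p) p"
    by (simp add: cinner_simps cinner_self_unit[OF p])
  then have "2 *\<^sub>C A z = 2 *\<^sub>C (cinner z p * cinner (A p) p) *\<^sub>C p"
    by (metis Ap eq' scaleC_two scaleC_scaleC)
  then have "A z = (cinner z p * cinner (A p) p) *\<^sub>C p"
    by (simp only: complex_vector.scale_cancel_left) simp
  then show "A z = scale_op (cinner (A p) p) (ketbra p p) z"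
    by (simp add: scale_op_apply ketbra_apply scaleC_scaleC mult.commute)
qed

lemma idempotent_below_ketbra_self:
  fixes A :: "'a::complex_inner \<Rightarrow> 'a"
  assumes p: "norm p = 1" and A: "A \<in> bounded_ops" and eq: "jordan_product A (ketbra p p) = A"
    and idem: "jordan_product A A = A" and nz: "A \<noteq> zero_op"
  shows "A = ketbra p p"
proof -
  define c where "c = cinner (A p) p"
  have Ac: "A = scale_op c (ketbra p p)"
    using jordan_unit_ketbra_self[OF p A eq] by (simp add: c_def)
  have "scale_op (c * c) (ketbra p p) = scale_op c (ketbra p p)"
    using idem unfolding Ac
    by (metis A Ac jordan_product_scale_left jordan_product_scale_right ketbra_bounded
        ketbra_self_idem p scale_op_scale_op)
  then have "c * c = c"
    using scale_op_cancel ketbra_self_nonzero[OF p] by blast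
  moreover have "c \<noteq> 0"
    using nz Ac by auto
  ultimately have "c = 1" by simp
  then show ?thesis
    using Ac by simp
qed

text \<open>
  Together with the previous lemma this characterises the line projections, among the
  projections, as the minimal nonzero ones.
\<close>

lemma ketbra_self_below_projection:
  fixes A :: "'a::complex_hilbert_space \<Rightarrow> 'a"
  assumes A: "A \<in> bounded_ops" and idem: "jordan_product A A = A" and sa: "cadjoint A = A"
    and nz: "A \<noteq> zero_op"
  shows "\<exists>p. norm p = 1 \<and> jordan_product (ketbra p p) A = ketbra p p"
proof -
  obtain w where w: "A w \<noteq> 0" using nz by auto
  define p where "p = complex_of_real (1 / norm (A w)) *\<^sub>C A w"
  have AA: "A (A w) = A w"
    using jordan_product_self[OF A, of w] idem by simp
  have p: "norm p = 1" unfolding p_def by (rule unit_scale[OF w])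
  have Ap: "A p = p" by (simp add: p_def bounded_ops_scale[OF A] AA)
  have "cinner (A z) p = cinner z p" for z
    using cinner_cadjoint[OF A, of z p] by (simp add: sa Ap)
  then have "jordan_product (ketbra p p) A = ketbra p p"
    by (intro jordan_product_eqI) (simp add: ketbra_apply bounded_ops_scale[OF A] Ap flip: scaleC_two)
  with p show ?thesis by blast
qed

lemma ketbra_self_orthogonal_iff:
  assumes p: "norm p = 1" and q: "norm q = 1"
  shows "jordan_product (ketbra p p) (ketbra q q) = zero_op \<longleftrightarrow> cinner p q = 0"
proof
  assume eq: "jordan_product (ketbra p p) (ketbra q q) = zero_op"
  have "cinner (ketbra p p (ketbra q q q) + ketbra q q (ketbra p p q)) p = cinner (2 *\<^sub>C 0) p"
    using jordan_product_eqD[OF eq] by metis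
  then have "cinner q p * (1 + cinner p q * cinner q p) = 0"
    by (simp add: ketbra_apply cinner_simps cinner_self_unit[OF p] cinner_self_unit[OF q] algebra_simps)
  moreover have "cinner p q * cinner q p = complex_of_real ((cmod (cinner p q))\<^sup>2)"
    using cinner_commute[of q p] by (simp add: complex_norm_square del: of_real_power)
  moreover have "1 + complex_of_real ((cmod (cinner p q))\<^sup>2) \<noteq> 0"
  proof -
    have "1 + (cmod (cinner p q))\<^sup>2 \<noteq> 0"
      using zero_le_power2[of "cmod (cinner p q)"] by linarith
    then show ?thesis
      by (metis of_real_1 of_real_add of_real_eq_0_iff)
  qed
  ultimately have "cinner q p = 0" by (metis mult_eq_0_iff)
  then show "cinner p q = 0" by (simp add: cinner_zero_commute)
next
  assume "cinner p q = 0"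
  moreover from this have "cinner q p = 0" by (simp add: cinner_zero_commute)
  ultimately show "jordan_product (ketbra p p) (ketbra q q) = zero_op"
    by (intro jordan_product_eqI) (simp add: ketbra_apply cinner_simps)
qed

lemma op_eqI_unit:
  fixes A B :: "'a::complex_inner \<Rightarrow> 'b::complex_inner"
  assumes A: "A \<in> bounded_ops" and B: "B \<in> bounded_ops" and "\<And>q. norm q = 1 \<Longrightarrow> A q = B q"
  shows "A = B"
proof
  fix z
  show "A z = B z"
  proof (cases "z = 0")
    case False
    have "A (c *\<^sub>C complex_of_real (1 / norm z) *\<^sub>C z) = B (c *\<^sub>C complex_of_real (1 / norm z) *\<^sub>C z)" for c
      by (simp only: bounded_ops_scale[OF A, of c] bounded_ops_scale[OF B, of c]
          assms(3)[OF unit_scale(1)[OF False]])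
    then show ?thesis
      using unit_scale(2)[OF False] by metis
  qed (simp add: bounded_ops_zero A B)
qed

text \<open>
  Compressing \<open>A Q + Q A\<close> to the line of \<open>q\<close> recovers \<open>\<langle>A q, q\<rangle>\<close>, and then evaluating at \<open>q\<close>
  recovers \<open>A q\<close>.
\<close>

lemma op_eqI_jordan_ketbra:
  fixes A B :: "'a::complex_inner \<Rightarrow> 'a"
  assumes A: "A \<in> bounded_ops" and B: "B \<in> bounded_ops"
    and eq: "\<And>q. norm q = 1 \<Longrightarrow> jordan_product A (ketbra q q) = jordan_product B (ketbra q q)"
  shows "A = B"
proof (rule op_eqI_unit[OF A B])
  fix q :: 'a assume q: "norm q = 1"
  have "A q + cinner (A q) q *\<^sub>C q = B q + cinner (B q) q *\<^sub>C q"
    using jordan_product_eqD[OF eq[OF q, symmetric], of q] 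
      jordan_product_eqD[OF refl, of A "ketbra q q" q]
    by (simp add: ketbra_apply cinner_self_unit[OF q] scaleC_one)
  moreover from arg_cong[OF this, of "\<lambda>v. cinner v q"] have "cinner (A q) q = cinner (B q) q"
    by (simp add: cinner_simps cinner_self_unit[OF q])
  ultimately show "A q = B q" by simp
qed

lemma half_sum_unit:
  fixes p q :: "'a::complex_inner"
  assumes p: "norm p = 1" and q: "norm q = 1" and pq: "cinner p q = 0"
  defines "h \<equiv> complex_of_real (1 / sqrt 2)"
  shows "norm (h *\<^sub>C (p + q)) = 1" "norm (h *\<^sub>C (p - q)) = 1"
    and "cinner (h *\<^sub>C (p + q)) (h *\<^sub>C (p - q)) = 0"
proof -
  have qp: "cinner q p = 0" using pq by (simp add: cinner_zero_commute)
  have hh: "h * cnj h = 1 / 2"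
    unfolding h_def complex_cnj_complex_of_real of_real_mult[symmetric] by (simp del: of_real_mult)
  have "cinner (h *\<^sub>C (p + q)) (h *\<^sub>C (p + q)) = (h * cnj h) * 2"
    by (simp add: cinner_simps pq qp cinner_self_unit[OF p] cinner_self_unit[OF q])
  then show "norm (h *\<^sub>C (p + q)) = 1" by (simp add: norm_eq_sqrt_cinner hh)
  have "cinner (h *\<^sub>C (p - q)) (h *\<^sub>C (p - q)) = (h * cnj h) * 2"
    by (simp add: cinner_simps pq qp cinner_self_unit[OF p] cinner_self_unit[OF q])
  then show "norm (h *\<^sub>C (p - q)) = 1" by (simp add: norm_eq_sqrt_cinner hh)
  show "cinner (h *\<^sub>C (p + q)) (h *\<^sub>C (p - q)) = 0"
    by (simp add: cinner_simps pq qp cinner_self_unit[OF p] cinner_self_unit[OF q])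
qed

text \<open>
  Left and right multiplication by the projection \<open>u u\<^sup>*\<close> commute and have eigenvalues 0 and 1, so
  the Jordan multiplication by it has no eigenvalues besides 0, 1/2 and 1.
\<close>

lemma jordan_eigen_half:
  fixes A :: "'a::complex_inner \<Rightarrow> 'a"
  assumes u: "norm u = 1" and A: "A \<in> bounded_ops" and nz: "A \<noteq> zero_op"
    and eq: "jordan_product A (ketbra u u) = scale_op c A" and c: "c \<noteq> 0" "c \<noteq> 1"
  shows "c = 1/2" and "cinner (A u) u = 0"
proof -
  have eq: "cinner z u *\<^sub>C A u + cinner (A z) u *\<^sub>C u = (2 * c) *\<^sub>C A z" for z
    using jordan_product_eqD[OF eq, of z]
    by (simp add: ketbra_apply scale_op_apply bounded_ops_scale[OF A])
  have "cinner (A u) u + cinner (A u) u = (2 * c) * cinner (A u) u"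
    using arg_cong[OF eq[of u], of "\<lambda>v. cinner v u"]
    by (simp add: cinner_simps cinner_self_unit[OF u])
  then have "(c - 1) * cinner (A u) u = 0" by (simp add: algebra_simps)
  then show Auu: "cinner (A u) u = 0" using c by simp
  show "c = 1/2"
  proof (rule ccontr)
    assume "c \<noteq> 1/2"
    then have c2: "2 * c \<noteq> 1" by (simp add: field_simps)
    have "1 *\<^sub>C A u = (2 * c) *\<^sub>C A u"
      using eq[of u] by (simp add: Auu cinner_self_unit[OF u])
    then have Au: "A u = 0" using c2 unfolding complex_vector.scale_cancel_right by auto
    have "A z = 0" for z
    proof -
      have eqz: "cinner (A z) u *\<^sub>C u = (2 * c) *\<^sub>C A z" using eq[of z] Au by simp
      have "1 * cinner (A z) u = (2 * c) * cinner (A z) u"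
        using arg_cong[OF eqz, of "\<lambda>v. cinner v u"]
        by (simp add: cinner_simps cinner_self_unit[OF u])
      then have "cinner (A z) u = 0" using c2 by auto
      then show ?thesis using eqz c by simp
    qed
    with nz show False by auto
  qed
qed

text \<open>
  The two eigenvalue equations leave only the entries of \<open>A\<close> that lead from the line of \<open>u\<close> to
  that of \<open>v\<close> or back, and the product of these two entries vanishes because \<open>A\<close> squares to zero.
\<close>

lemma square_zero_two_half_eigen:
  fixes A :: "'a::complex_inner \<Rightarrow> 'a"
  assumes u: "norm u = 1" and v: "norm v = 1" and uv: "cinner u v = 0"
    and A: "A \<in> bounded_ops" and nz: "A \<noteq> zero_op"
    and equ: "jordan_product A (ketbra u u) = scale_op (1/2) A"
    and eqv: "jordan_product A (ketbra v v) = scale_op (1/2) A"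
    and sq: "jordan_product A A = zero_op"
  shows "\<exists>a. a \<noteq> 0 \<and> (A = scale_op a (ketbra u v) \<or> A = scale_op a (ketbra v u))"
proof -
  have vu: "cinner v u = 0" using uv by (simp add: cinner_zero_commute)
  have eu: "cinner z u *\<^sub>C A u + cinner (A z) u *\<^sub>C u = A z" for z
    using jordan_product_eqD[OF equ, of z]
    by (simp add: ketbra_apply scale_op_apply bounded_ops_scale[OF A] scaleC_one)
  have ev: "cinner z v *\<^sub>C A v + cinner (A z) v *\<^sub>C v = A z" for z
    using jordan_product_eqD[OF eqv, of z]
    by (simp add: ketbra_apply scale_op_apply bounded_ops_scale[OF A] scaleC_one)
  define a where "a = cinner (A v) u"
  define b where "b = cinner (A u) v"
  have Au: "A u = b *\<^sub>C v" using ev[of u] uv by (simp add: b_def)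
  have "cinner (A z) u = cinner z v * a" for z
    using arg_cong[OF ev[of z], of "\<lambda>w. cinner w u"] by (simp add: cinner_simps vu a_def)
  then have Az: "A z = (cinner z u * b) *\<^sub>C v + (cinner z v * a) *\<^sub>C u" for z
    using eu[of z] Au by (simp add: scaleC_scaleC)
  have "A (A u) = 0" using jordan_product_self[OF A, of u] sq by simp
  moreover have "A (A u) = (a * b) *\<^sub>C u"
    unfolding Au bounded_ops_scale[OF A] Az[of v]
    by (simp add: vu cinner_self_unit[OF v] scaleC_scaleC mult.commute)
  ultimately have "a = 0 \<or> b = 0" using unit_nonzero[OF u] by simp
  then show ?thesis
  proof
    assume "a = 0"
    then have "A = scale_op b (ketbra v u)"
      using Az by (auto simp: scale_op_apply ketbra_apply scaleC_scaleC mult.commute)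
    moreover from this nz have "b \<noteq> 0" by auto
    ultimately show ?thesis by blast
  next
    assume "b = 0"
    then have "A = scale_op a (ketbra u v)"
      using Az by (auto simp: scale_op_apply ketbra_apply scaleC_scaleC mult.commute)
    moreover from this nz have "a \<noteq> 0" by auto
    ultimately show ?thesis by blast
  qed
qed

text \<open>
  Since \<open>N = x y\<^sup>*\<close> squares to zero, both sides are half of \<open>N A N\<close>. In this way a matrix entry is
  expressed by Jordan products alone.
\<close>

lemma jordan_sandwich:
  assumes A: "A \<in> bounded_ops" and xy: "cinner x y = 0"
  shows "jordan_product (ketbra x y) (jordan_product A (ketbra x y)) =
    scale_op (1/2 * cinner (A x) y) (ketbra x y)"
proof (rule jordan_product_eqI)
  fix z
  show "ketbra x y (jordan_product A (ketbra x y) z) + jordan_product A (ketbra x y) (ketbra x y z)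
    = 2 *\<^sub>C scale_op (1/2 * cinner (A x) y) (ketbra x y) z"
    by (simp add: ketbra_apply scale_op_apply jordan_product_apply cinner_simps xy
        bounded_ops_simps[OF A] scaleC_scaleC flip: scaleC_add_left)
qed

lemma jordan_square_zero: "cinner x y = 0 \<Longrightarrow> jordan_product (ketbra x y) (ketbra x y) = zero_op"
  by (rule jordan_product_eqI) (simp add: ketbra_apply cinner_simps)

lemma ketbra_jordan_range:
  assumes "norm x = 1" "cinner x y = 0"
  shows "jordan_product (ketbra x y) (ketbra x x) = scale_op (1/2) (ketbra x y)"
  by (rule jordan_product_eqI)
    (simp add: ketbra_apply scale_op_apply cinner_simps assms cinner_self_unit scaleC_one)

lemma ketbra_jordan_support:
  assumes "norm y = 1" "cinner x y = 0"
  shows "jordan_product (ketbra x y) (ketbra y y) = scale_op (1/2) (ketbra x y)"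
  by (rule jordan_product_eqI)
    (simp add: ketbra_apply scale_op_apply cinner_simps assms cinner_self_unit scaleC_one)

lemma ketbra_nonzero:
  assumes "x \<noteq> 0" "norm y = 1"
  shows "ketbra x y \<noteq> zero_op"
proof
  assume "ketbra x y = zero_op"
  from fun_cong[OF this, of y] assms show False
    by (simp add: ketbra_apply cinner_self_unit scaleC_one)
qed

lemma scale_op_nonzero: "a \<noteq> 0 \<Longrightarrow> A \<noteq> zero_op \<Longrightarrow> scale_op a A \<noteq> zero_op"
  by (auto simp: scale_op_apply fun_eq_iff)

lemma resolution_ketbra:
  fixes x y :: "'a::complex_inner"
  defines "h \<equiv> complex_of_real (1 / sqrt 2)"
  shows "add_op (ketbra (h *\<^sub>C (x + y)) (h *\<^sub>C (x + y))) (ketbra (h *\<^sub>C (x - y)) (h *\<^sub>C (x - y)))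
    = add_op (ketbra x x) (ketbra y y)"
proof
  fix z :: 'a
  have hh: "h * h = 1 / 2" "cnj h = h"
    unfolding h_def complex_cnj_complex_of_real of_real_mult[symmetric] by (simp_all del: of_real_mult)
  have hhc: "h * (h * c) = c / 2" for c
    using hh(1) by (simp add: mult.assoc[symmetric])
  have *: "ketbra (h *\<^sub>C w) (h *\<^sub>C w) z = (1/2) *\<^sub>C (cinner z w *\<^sub>C w)" for w
    by (simp add: ketbra_apply cinner_simps hh(2) hhc scaleC_scaleC mult.commute mult.left_commute)
  have "(1/2) *\<^sub>C (cinner z (x + y) *\<^sub>C (x + y)) + (1/2) *\<^sub>C (cinner z (x - y) *\<^sub>C (x - y))
    = (1/2) *\<^sub>C (2 *\<^sub>C (cinner z x *\<^sub>C x) + 2 *\<^sub>C (cinner z y *\<^sub>C y))"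
    unfolding scaleC_two by (simp add: cinner_simps scaleC_simps algebra_simps)
  then show "add_op (ketbra (h *\<^sub>C (x + y)) (h *\<^sub>C (x + y))) (ketbra (h *\<^sub>C (x - y)) (h *\<^sub>C (x - y))) z
    = add_op (ketbra x x) (ketbra y y) z"
    unfolding add_op_apply * by (simp add: ketbra_apply scaleC_add_right scaleC_scaleC)
qed

lemma ex_orthogonal_unit:
  fixes e x y :: "'a::complex_inner"
  assumes e: "norm e = 1" and xy: "norm x = 1" "norm y = 1" "cinner x y = 0"
  shows "\<exists>v. norm v = 1 \<and> cinner e v = 0"
proof -
  have "\<exists>w. w - cinner w e *\<^sub>C e \<noteq> 0"
  proof (rule ccontr)
    assume "\<not> ?thesis"
    then have eq: "w = cinner w e *\<^sub>C e" for w by simp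
    have "x \<noteq> 0" "y \<noteq> 0" using xy unit_nonzero by auto
    then have "cinner x e \<noteq> 0" "cinner y e \<noteq> 0" using eq[of x] eq[of y] by auto
    moreover have "cinner x y = cinner x e * cnj (cinner y e)"
      by (subst eq[of x], subst eq[of y]) (simp add: cinner_simps cinner_self_unit[OF e])
    ultimately show False using xy by simp
  qed
  then obtain w where w: "w - cinner w e *\<^sub>C e \<noteq> 0" by blast
  let ?v = "complex_of_real (1 / norm (w - cinner w e *\<^sub>C e)) *\<^sub>C (w - cinner w e *\<^sub>C e)"
  have "cinner e (w - cinner w e *\<^sub>C e) = 0"
    by (simp add: cinner_simps cinner_self_unit[OF e] cinner_commute[of e w])
  then have "cinner e ?v = 0" by (simp add: cinner_scaleC_right)
  with unit_scale(1)[OF w] show ?thesis by blast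
qed

lemma orthogonal_decomposition:
  fixes e x :: "'a::complex_inner"
  assumes e: "norm e = 1"
  shows "\<exists>w. x = cinner x e *\<^sub>C e + w \<and> cinner w e = 0"
  by (rule exI[of _ "x - cinner x e *\<^sub>C e"]) (simp add: cinner_simps cinner_self_unit[OF e])

text \<open>
  The off-diagonal entries determine an operator only up to a multiple of the identity.
  That multiple shows up in an off-diagonal entry of the Jordan product with \<open>e e\<^sup>*\<close>, taken with
  respect to an orthonormal pair whose lines bisect that of \<open>e\<close> and an orthogonal one.
\<close>

lemma op_eqI_offdiagonal:
  fixes S T :: "'a::complex_inner \<Rightarrow> 'a"
  assumes S: "S \<in> bounded_ops" and T: "T \<in> bounded_ops"
    and dim: "\<exists>x y :: 'a. norm x = 1 \<and> norm y = 1 \<and> cinner x y = 0"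
    and off: "\<And>u v. norm u = 1 \<Longrightarrow> norm v = 1 \<Longrightarrow> cinner u v = 0 \<Longrightarrow> cinner (S u) v = cinner (T u) v"
    and off_jp: "\<And>e u v. norm e = 1 \<Longrightarrow> norm u = 1 \<Longrightarrow> norm v = 1 \<Longrightarrow> cinner u v = 0 \<Longrightarrow>
      cinner (jordan_product S (ketbra e e) u) v = cinner (jordan_product T (ketbra e e) u) v"
  shows "S = T"
proof (rule op_eqI_unit[OF S T])
  fix e :: 'a assume e: "norm e = 1"
  obtain v where v: "norm v = 1" and ev: "cinner e v = 0"
    using ex_orthogonal_unit[OF e] dim by blast
  have ve: "cinner v e = 0" using ev by (simp add: cinner_zero_commute)
  define h where "h = complex_of_real (1 / sqrt 2)"
  have h: "h \<noteq> 0" by (simp add: h_def)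
  have *: "cinner (jordan_product R (ketbra e e) (h *\<^sub>C (e + v))) (h *\<^sub>C (e - v)) =
      h * cnj h * (cinner (R e) e + (1/2) * (cinner (R v) e - cinner (R e) v))"
    if R: "R \<in> bounded_ops" for R
    by (simp add: jordan_product_apply ketbra_apply bounded_ops_simps[OF R] cinner_simps
        cinner_self_unit e v ev ve scaleC_one algebra_simps)
  have "cinner (S e) e = cinner (T e) e"
    using off_jp[OF e half_sum_unit[OF e v ev]] off[OF e v ev] off[OF v e ve] h
    unfolding h_def[symmetric] *[OF S] *[OF T] by simp
  then have de: "cinner (S e - T e) e = 0" by (simp add: cinner_simps)
  show "S e = T e"
  proof (rule ccontr)
    assume "S e \<noteq> T e"
    then have d: "S e - T e \<noteq> 0" by simp
    let ?w = "complex_of_real (1 / norm (S e - T e)) *\<^sub>C (S e - T e)"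
    have "cinner e ?w = 0"
      using de by (simp add: cinner_scaleC_right cinner_zero_commute)
    then have "cinner (S e - T e) ?w = 0"
      using off[OF e unit_scale(1)[OF d]] by (simp add: cinner_diff_left)
    with d show False
      by (simp add: cinner_scaleC_right cinner_eq_zero_iff)
  qed
qed

lemma ketbra_zero_left: "ketbra 0 y = zero_op"
  by (auto simp: ketbra_apply)

lemma ketbra_through_unit:
  assumes e: "norm e = 1"
  shows "jordan_product (ketbra x e) (ketbra e y) =
    scale_op (1/2) (add_op (ketbra x y) (scale_op (cinner x y) (ketbra e e)))"
  by (rule jordan_product_eqI)
    (simp add: ketbra_apply scale_op_apply add_op_apply cinner_simps cinner_self_unit[OF e]
      scaleC_simps scaleC_one mult.commute)

lemma jordan_product_ketbra_self:
  fixes A :: "'a::complex_hilbert_space \<Rightarrow> 'a"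
  assumes A: "A \<in> bounded_ops"
  shows "jordan_product A (ketbra x x) =
    scale_op (1/2) (add_op (ketbra (A x) x) (ketbra x (cadjoint A x)))"
  by (rule jordan_product_eqI)
    (simp add: ketbra_apply scale_op_apply add_op_apply bounded_ops_simps[OF A]
      cinner_cadjoint[OF A] scaleC_simps scaleC_one)

text \<open>
  One Gram--Schmidt step, applied to two distinct vectors of a basis.
\<close>

lemma orthonormal_pair_of_cdim_greater_1:
  assumes "cdim_greater TYPE('a::complex_inner) 1"
  shows "\<exists>x y :: 'a. norm x = 1 \<and> norm y = 1 \<and> cinner x y = 0"
proof -
  obtain B :: "'a set" where indep: "\<not> cdependent B" and card: "finite B \<longrightarrow> 1 < card B"
    using assms unfolding cdim_greater_def by blast
  obtain b where b: "b \<in> B" using card by (cases "B = {}") auto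
  have "B \<noteq> {b}" using card by auto
  then obtain c where c: "c \<in> B" "c \<noteq> b" using b by blast
  have b0: "b \<noteq> 0" using complex_vector.dependent_zero[of B] indep b by auto
  define e where "e = complex_of_real (1 / norm b) *\<^sub>C b"
  have e: "norm e = 1" unfolding e_def by (rule unit_scale(1)[OF b0])
  define w where "w = c - cinner c e *\<^sub>C e"
  have "w \<noteq> 0"
  proof
    assume "w = 0"
    then have "c = (cinner c e * complex_of_real (1 / norm b)) *\<^sub>C b"
      by (simp add: w_def e_def scaleC_scaleC)
    moreover have "\<dots> \<in> cspan (B - {c})"
      using b c by (intro complex_vector.span_scale complex_vector.span_base) auto
    ultimately have "c \<in> cspan (B - {c})" by simp
    then show False using indep c(1) unfolding complex_vector.dependent_def by blast
  qed
  moreover have "cinner e w = 0"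
    by (simp add: w_def cinner_simps cinner_self_unit[OF e] cinner_commute[of e c])
  then have "cinner e (complex_of_real (1 / norm w) *\<^sub>C w) = 0"
    by (simp add: cinner_scaleC_right)
  ultimately show ?thesis using e unit_scale(1) by blast
qed

section \<open>Standard operator algebras\<close>

lemma
  assumes "standard_operator_algebra \<A>"
  shows soa_bounded: "A \<in> \<A> \<Longrightarrow> A \<in> bounded_ops"
    and soa_ketbra: "ketbra x y \<in> \<A>"
    and soa_add: "A \<in> \<A> \<Longrightarrow> B \<in> \<A> \<Longrightarrow> add_op A B \<in> \<A>"
    and soa_scale: "A \<in> \<A> \<Longrightarrow> scale_op c A \<in> \<A>"
    and soa_jordan_product: "A \<in> \<A> \<Longrightarrow> B \<in> \<A> \<Longrightarrow> jordan_product A B \<in> \<A>"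
proof -
  show "A \<in> \<A> \<Longrightarrow> A \<in> bounded_ops"
    using assms by (auto simp: standard_operator_algebra_def)
  show "ketbra x y \<in> \<A>"
    using assms ketbra_finite_rank by (auto simp: standard_operator_algebra_def)
  show add: "add_op A B \<in> \<A>" if "A \<in> \<A>" "B \<in> \<A>" for A B
    using assms that by (auto simp: standard_operator_algebra_def add_op_def)
  show scale: "scale_op c A \<in> \<A>" if "A \<in> \<A>" for c A
    using assms that by (auto simp: standard_operator_algebra_def scale_op_def)
  assume AB: "A \<in> \<A>" "B \<in> \<A>"
  then have "A \<circ> B \<in> \<A>" "B \<circ> A \<in> \<A>"
    using assms by (auto simp: standard_operator_algebra_def)
  from scale[OF add[OF this], of "1/2"] show "jordan_product A B \<in> \<A>"
    by (simp add: jordan_product_def scale_op_def add_op_def)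
qed

section \<open>Endomorphisms of the complex field\<close>

text \<open>
  Squares are mapped to squares, so \<open>g\<close> is monotone, and it fixes the rational numbers.
\<close>

lemma real_ring_endo_id:
  fixes g :: "real \<Rightarrow> real"
  assumes add: "\<And>a b. g (a + b) = g a + g b" and mult: "\<And>a b. g (a * b) = g a * g b"
    and one: "g 1 = 1"
  shows "g r = r"
proof -
  have zero: "g 0 = 0" using add[of 0 0] by simp
  have minus: "g (- a) = - g a" for a
    using add[of a "- a"] unfolding add.right_inverse zero by linarith
  have nat: "g (real n) = real n" for n
    by (induction n) (simp_all add: zero add one)
  have int: "g (of_int k) = of_int k" for k
    by (cases k rule: int_cases2) (simp_all add: nat minus)
  have rat: "g q = q" if q: "q \<in> \<rat>" for q
  proof -
    obtain a b where b: "b > 0" and qe: "q = of_int a / of_int b"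
      using Rats_cases'[OF q] by blast
    have qb: "q * of_int b = of_int a" unfolding qe using b by simp
    have "g q * of_int b = g (q * of_int b)" by (simp only: mult int)
    also have "\<dots> = q * of_int b" by (simp only: qb int)
    finally show ?thesis using b by simp
  qed
  have pos: "0 \<le> g a" if "0 \<le> a" for a
    using mult[of "sqrt a" "sqrt a"] that by simp
  have mono: "g a \<le> g b" if "a \<le> b" for a b
    using pos[of "b - a"] add[of "b - a" a] that by simp
  show ?thesis
  proof (rule ccontr)
    assume "g r \<noteq> r"
    then consider "g r < r" | "r < g r" by linarith
    then show False
    proof cases
      case 1
      then obtain q where "q \<in> \<rat>" "g r < q" "q < r" using Rats_dense_in_real by blast
      then show False using rat[of q] mono[of q r] by simp
    next
      case 2
      then obtain q where "q \<in> \<rat>" "r < q" "q < g r" using Rats_dense_in_real by blast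
      then show False using rat[of q] mono[of r q] by simp
    qed
  qed
qed

lemma complex_ring_endo_cases:
  fixes f :: "complex \<Rightarrow> complex"
  assumes add: "\<And>a b. f (a + b) = f a + f b" and mult: "\<And>a b. f (a * b) = f a * f b"
    and one: "f 1 = 1" and cnj: "\<And>a. f (cnj a) = cnj (f a)"
  shows "(\<forall>z. f z = z) \<or> (\<forall>z. f z = cnj z)"
proof -
  have real: "f (of_real r) = of_real (Re (f (of_real r)))" for r
    using cnj[of "of_real r"] by (simp add: complex_eq_iff)
  have "Re (f (of_real r)) = r" for r
  proof (rule real_ring_endo_id)
    show "Re (f (of_real (a * b))) = Re (f (of_real a)) * Re (f (of_real b))" for a b
      by (simp only: of_real_mult mult, subst (1 2) real) simp
  qed (simp_all add: add one)
  then have real: "f (of_real r) = of_real r" for r using real by simp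
  have "f \<i> * f \<i> = f (of_real (-1))" by (simp flip: mult)
  then have "f \<i> * f \<i> = \<i> * \<i>" by (simp only: real) simp
  then have "f \<i> = \<i> \<or> f \<i> = - \<i>" using square_eq_iff by blast
  moreover have fz: "f z = of_real (Re z) + f \<i> * of_real (Im z)" for z
    using arg_cong[OF complex_eq[of z], of f] by (simp only: add mult real)
  moreover have "cnj z = of_real (Re z) + - \<i> * of_real (Im z)" for z
    by (simp add: complex_eq_iff)
  moreover have "z = of_real (Re z) + \<i> * of_real (Im z)" for z
    by (rule complex_eq)
  ultimately show ?thesis by metis
qed

section \<open>Jordan multiplicative bijections\<close>

locale jordan_star_iso =
  fixes \<A> :: "('h::complex_hilbert_space \<Rightarrow> 'h) set"
    and \<B> :: "('k::complex_hilbert_space \<Rightarrow> 'k) set"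
    and \<phi> :: "('h \<Rightarrow> 'h) \<Rightarrow> ('k \<Rightarrow> 'k)"
  assumes dim: "\<exists>x y :: 'h. norm x = 1 \<and> norm y = 1 \<and> cinner x y = 0"
    and soa_dom: "standard_operator_algebra \<A>" 
    and adj_dom: "\<And>A. A \<in> \<A> \<Longrightarrow> cadjoint A \<in> \<A>"
    and soa_cod: "standard_operator_algebra \<B>"
    and bij: "bij_betw \<phi> \<A> \<B>"
    and phi_adj: "\<And>A. A \<in> \<A> \<Longrightarrow> \<phi> (cadjoint A) = cadjoint (\<phi> A)"
    and phi_jp: "\<And>A B. A \<in> \<A> \<Longrightarrow> B \<in> \<A> \<Longrightarrow>
           \<phi> (jordan_product A B) = jordan_product (\<phi> A) (\<phi> B)"
begin

lemmas dom_bounded = soa_bounded[OF soa_dom]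
lemmas cod_bounded = soa_bounded[OF soa_cod]

lemmas dom_closed [simp] =
  soa_ketbra[OF soa_dom] soa_add[OF soa_dom] soa_scale[OF soa_dom] soa_jordan_product[OF soa_dom]
  adj_dom
lemmas cod_closed [simp] =
  soa_ketbra[OF soa_cod] soa_add[OF soa_cod] soa_scale[OF soa_cod] soa_jordan_product[OF soa_cod]

lemma phi_in [simp]: "A \<in> \<A> \<Longrightarrow> \<phi> A \<in> \<B>"
  using bij by (auto simp: bij_betw_def)

lemma phi_bounded: "A \<in> \<A> \<Longrightarrow> \<phi> A \<in> bounded_ops"
  by (simp add: cod_bounded)

lemma phi_eq_iff: "A \<in> \<A> \<Longrightarrow> B \<in> \<A> \<Longrightarrow> \<phi> A = \<phi> B \<longleftrightarrow> A = B"
  using bij by (auto simp: bij_betw_def inj_on_def)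

lemma phi_surj: "B \<in> \<B> \<Longrightarrow> \<exists>A\<in>\<A>. \<phi> A = B"
  using bij by (auto simp: bij_betw_def)

lemma phi_jp_iff:
  "A \<in> \<A> \<Longrightarrow> B \<in> \<A> \<Longrightarrow> C \<in> \<A> \<Longrightarrow> jordan_product (\<phi> A) (\<phi> B) = \<phi> C \<longleftrightarrow> jordan_product A B = C"
  by (simp add: phi_jp[symmetric] phi_eq_iff)

lemma zero_in_dom [simp]: "zero_op \<in> \<A>"
  using dom_closed(3)[OF dom_closed(1), of 0] by simp

lemma zero_in_cod [simp]: "zero_op \<in> \<B>"
  using cod_closed(3)[OF cod_closed(1), of 0] by simp

lemma jordan_product_zero: "A \<in> bounded_ops \<Longrightarrow> jordan_product A zero_op = zero_op"
  by (rule jordan_product_eqI) (simp add: bounded_ops_zero)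

lemma phi_zero: "\<phi> zero_op = zero_op"
proof -
  obtain Z where Z: "Z \<in> \<A>" "\<phi> Z = zero_op" using phi_surj[OF zero_in_cod] by blast
  have "\<phi> zero_op = \<phi> (jordan_product zero_op Z)"
    using Z jordan_product_zero[OF dom_bounded] by (simp add: jordan_product_commute)
  also have "\<dots> = jordan_product (\<phi> zero_op) zero_op" using Z phi_jp by simp
  also have "\<dots> = zero_op" by (rule jordan_product_zero[OF phi_bounded]) simp
  finally show ?thesis .
qed

lemma phi_nonzero: "A \<in> \<A> \<Longrightarrow> A \<noteq> zero_op \<Longrightarrow> \<phi> A \<noteq> zero_op"
  using phi_eq_iff[of A zero_op] by (simp add: phi_zero)

text \<open>
  The preimage of a line projection is a nonzero projection, and it dominates some line
  projection, whose image is then a nonzero idempotent below a line projection.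
\<close>

lemma preimage_ketbra_self:
  assumes u: "norm u = 1"
  shows "\<exists>p. norm p = 1 \<and> \<phi> (ketbra p p) = ketbra u u"
proof -
  obtain Q where Q: "Q \<in> \<A>" "\<phi> Q = ketbra u u" using phi_surj[OF cod_closed(1)] by blast
  have "jordan_product Q Q = Q"
    using phi_jp_iff[of Q Q Q] Q ketbra_self_idem[OF u] by simp
  moreover have "cadjoint Q = Q"
    using phi_eq_iff[of "cadjoint Q" Q] phi_adj[of Q] Q by (simp add: cadjoint_ketbra)
  moreover have "Q \<noteq> zero_op"
    using Q ketbra_self_nonzero[OF u] phi_zero by auto
  ultimately obtain p where p: "norm p = 1" "jordan_product (ketbra p p) Q = ketbra p p"
    using ketbra_self_below_projection dom_bounded Q(1) by blast
  have "\<phi> (ketbra p p) = ketbra u u"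
  proof (rule idempotent_below_ketbra_self[OF u])
    show "jordan_product (\<phi> (ketbra p p)) (ketbra u u) = \<phi> (ketbra p p)"
      using Q p phi_jp_iff[of "ketbra p p" Q "ketbra p p"] by simp
    show "jordan_product (\<phi> (ketbra p p)) (\<phi> (ketbra p p)) = \<phi> (ketbra p p)"
      using phi_jp_iff[of "ketbra p p" "ketbra p p" "ketbra p p"] ketbra_self_idem[OF p(1)] by simp
  qed (simp_all add: p phi_bounded phi_nonzero ketbra_self_nonzero)
  with p show ?thesis by blast
qed

lemma image_ketbra_self:
  assumes p: "norm p = 1"
  shows "\<exists>u. norm u = 1 \<and> \<phi> (ketbra p p) = ketbra u u"
proof -
  have "jordan_product (\<phi> (ketbra p p)) (\<phi> (ketbra p p)) = \<phi> (ketbra p p)"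
    using phi_jp_iff[of "ketbra p p" "ketbra p p" "ketbra p p"] ketbra_self_idem[OF p] by simp
  moreover have "cadjoint (\<phi> (ketbra p p)) = \<phi> (ketbra p p)"
    using phi_adj[of "ketbra p p"] by (simp add: cadjoint_ketbra)
  ultimately obtain u where u: "norm u = 1"
    "jordan_product (ketbra u u) (\<phi> (ketbra p p)) = ketbra u u"
    using ketbra_self_below_projection[of "\<phi> (ketbra p p)"] phi_bounded phi_nonzero
      ketbra_self_nonzero[OF p] by auto
  obtain q where q: "norm q = 1" "\<phi> (ketbra q q) = ketbra u u"
    using preimage_ketbra_self[OF u(1)] by blast
  have "ketbra q q = ketbra p p"
  proof (rule idempotent_below_ketbra_self[OF p])
    show "jordan_product (ketbra q q) (ketbra p p) = ketbra q q"
      using u q phi_jp_iff[of "ketbra q q" "ketbra p p" "ketbra q q"] by simp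
  qed (simp_all add: ketbra_bounded ketbra_self_idem ketbra_self_nonzero q)
  with u q show ?thesis by auto
qed

lemma orthogonal_iff:
  assumes "norm p = 1" "norm q = 1" "norm u = 1" "norm v = 1"
    and "\<phi> (ketbra p p) = ketbra u u" "\<phi> (ketbra q q) = ketbra v v"
  shows "cinner u v = 0 \<longleftrightarrow> cinner p q = 0"
  using phi_jp_iff[of "ketbra p p" "ketbra q q" zero_op] assms
  by (simp add: ketbra_self_orthogonal_iff phi_zero)

section \<open>Homogeneity\<close>

text \<open>
  The multiples of a line projection \<open>P\<close> are the fixed points of the Jordan multiplication by \<open>P\<close>.
\<close>

lemma phi_scale_ketbra_self:
  assumes p: "norm p = 1"
  shows "\<exists>d. \<phi> (scale_op c (ketbra p p)) = scale_op d (\<phi> (ketbra p p))"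
proof -
  obtain u where u: "norm u = 1" "\<phi> (ketbra p p) = ketbra u u"
    using image_ketbra_self[OF p] by blast
  have "jordan_product (\<phi> (scale_op c (ketbra p p))) (ketbra u u) = \<phi> (scale_op c (ketbra p p))"
    using phi_jp_iff[of "scale_op c (ketbra p p)" "ketbra p p" "scale_op c (ketbra p p)"] u
    by (simp add: jordan_product_scale_left ketbra_bounded ketbra_self_idem[OF p])
  then show ?thesis
    using jordan_unit_ketbra_self[OF u(1) phi_bounded, of "scale_op c (ketbra p p)"] u(2) by auto
qed

text \<open>
  A scalar may be moved from one factor of \<open>P \<circ> Q\<close> to the other, and \<open>P \<circ> Q\<close> is nonzero
  unless the lines are orthogonal.
\<close>

lemma scale_coefficient_unique:
  assumes p: "norm p = 1" and q: "norm q = 1" and pq: "cinner p q \<noteq> 0"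
    and "\<phi> (scale_op c (ketbra p p)) = scale_op d (\<phi> (ketbra p p))"
    and "\<phi> (scale_op c (ketbra q q)) = scale_op d' (\<phi> (ketbra q q))"
  shows "d = d'"
proof -
  let ?P = "ketbra p p" and ?Q = "ketbra q q"
  have "scale_op d (jordan_product (\<phi> ?P) (\<phi> ?Q)) = \<phi> (jordan_product (scale_op c ?P) ?Q)"
    by (simp add: phi_jp assms phi_bounded jordan_product_scale_left)
  also have "jordan_product (scale_op c ?P) ?Q = jordan_product ?P (scale_op c ?Q)"
    by (simp add: jordan_product_scale_left jordan_product_scale_right ketbra_bounded)
  also have "\<phi> \<dots> = scale_op d' (jordan_product (\<phi> ?P) (\<phi> ?Q))"
    by (simp add: phi_jp assms phi_bounded jordan_product_scale_right)
  finally show ?thesis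
  proof (rule scale_op_cancel)
    show "jordan_product (\<phi> ?P) (\<phi> ?Q) \<noteq> zero_op"
      using pq phi_nonzero[of "jordan_product ?P ?Q"] ketbra_self_orthogonal_iff[OF p q]
      by (simp add: phi_jp)
  qed
qed

lemma scale_coefficient_ketbra_self:
  "\<exists>d. \<forall>p. norm p = 1 \<longrightarrow> \<phi> (scale_op c (ketbra p p)) = scale_op d (\<phi> (ketbra p p))"
proof -
  obtain e :: 'h where e: "norm e = 1" using dim by blast
  obtain d where d: "\<phi> (scale_op c (ketbra e e)) = scale_op d (\<phi> (ketbra e e))"
    using phi_scale_ketbra_self[OF e] by blast
  have "\<phi> (scale_op c (ketbra p p)) = scale_op d (\<phi> (ketbra p p))" if p: "norm p = 1" for p
  proof -
    obtain d' where d': "\<phi> (scale_op c (ketbra p p)) = scale_op d' (\<phi> (ketbra p p))"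
      using phi_scale_ketbra_self[OF p] by blast
    have "d = d'"
    proof (cases "cinner e p = 0")
      case True
      define r where "r = complex_of_real (1 / sqrt 2) *\<^sub>C (e + p)"
      have r: "norm r = 1" unfolding r_def by (rule half_sum_unit(1)[OF e p True])
      have "cinner e r \<noteq> 0" "cinner r p \<noteq> 0"
        by (simp_all add: r_def cinner_simps True cinner_self_unit e p)
      moreover obtain d'' where "\<phi> (scale_op c (ketbra r r)) = scale_op d'' (\<phi> (ketbra r r))"
        using phi_scale_ketbra_self[OF r] by blast
      ultimately show ?thesis
        using scale_coefficient_unique[OF e r _ d] scale_coefficient_unique[OF r p _ _ d'] by blast
    qed (use scale_coefficient_unique[OF e p _ d d'] in blast)
    with d' show ?thesis by simp
  qed
  then show ?thesis by blast
qed

lemma ex_scale_coefficient: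
  "\<exists>d. \<forall>A\<in>\<A>. \<phi> (scale_op c A) = scale_op d (\<phi> A)"
proof -
  obtain d where
    d: "\<And>p. norm p = 1 \<Longrightarrow> \<phi> (scale_op c (ketbra p p)) = scale_op d (\<phi> (ketbra p p))"
    using scale_coefficient_ketbra_self by blast
  have "\<phi> (scale_op c A) = scale_op d (\<phi> A)" if A: "A \<in> \<A>" for A
  proof (rule op_eqI_jordan_ketbra)
    fix u :: 'k assume "norm u = 1"
    then obtain p where p: "norm p = 1" "\<phi> (ketbra p p) = ketbra u u"
      using preimage_ketbra_self by blast
    let ?P = "ketbra p p"
    have "jordan_product (\<phi> (scale_op c A)) (\<phi> ?P) = \<phi> (jordan_product A (scale_op c ?P))"
      using A by (simp add: phi_jp[symmetric] jordan_product_scale_left jordan_product_scale_right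
          ketbra_bounded dom_bounded)
    also have "\<dots> = jordan_product (scale_op d (\<phi> A)) (\<phi> ?P)"
      using A by (simp add: phi_jp d[OF p(1)] jordan_product_scale_left jordan_product_scale_right
          phi_bounded)
    finally show "jordan_product (\<phi> (scale_op c A)) (ketbra u u) =
      jordan_product (scale_op d (\<phi> A)) (ketbra u u)" by (simp add: p(2))
  qed (simp_all add: A cod_bounded)
  then show ?thesis by blast
qed

text \<open>
  The field automorphism by which \<open>\<phi>\<close> twists scalars.
\<close>

definition coeff :: "complex \<Rightarrow> complex" where
  "coeff c = (SOME d. \<forall>A\<in>\<A>. \<phi> (scale_op c A) = scale_op d (\<phi> A))"

lemma phi_scale: "A \<in> \<A> \<Longrightarrow> \<phi> (scale_op c A) = scale_op (coeff c) (\<phi> A)"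
  using someI_ex[OF ex_scale_coefficient[of c]] by (simp add: coeff_def)

lemma ex_nonzero: "\<exists>A\<in>\<A>. cadjoint A = A \<and> A \<noteq> zero_op"
proof -
  obtain e :: 'h where e: "norm e = 1" using dim by blast
  then show ?thesis
    by (intro bexI[of _ "ketbra e e"]) (simp_all add: cadjoint_ketbra ketbra_self_nonzero)
qed

lemma coeff_eqI:
  assumes "A \<in> \<A>" "A \<noteq> zero_op" "\<phi> (scale_op c A) = scale_op d (\<phi> A)"
  shows "coeff c = d"
  by (rule scale_op_cancel[OF _ phi_nonzero[OF assms(1,2)]])
    (simp only: phi_scale[OF assms(1), symmetric] assms(3))

lemma coeff_mult: "coeff (c * d) = coeff c * coeff d"
proof -
  obtain A where A: "A \<in> \<A>" "A \<noteq> zero_op" using ex_nonzero by blast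
  then show ?thesis
    by (intro coeff_eqI[OF A]) (simp add: scale_op_scale_op[symmetric] phi_scale)
qed

lemma coeff_one: "coeff 1 = 1"
proof -
  obtain A where A: "A \<in> \<A>" "A \<noteq> zero_op" using ex_nonzero by blast
  then show ?thesis by (intro coeff_eqI[OF A]) simp
qed

lemma coeff_zero: "coeff 0 = 0"
proof -
  obtain A where A: "A \<in> \<A>" "A \<noteq> zero_op" using ex_nonzero by blast
  then show ?thesis by (intro coeff_eqI[OF A]) (simp add: phi_zero)
qed

lemma coeff_inj: "coeff c = coeff d \<Longrightarrow> c = d"
proof -
  assume eq: "coeff c = coeff d"
  obtain A where A: "A \<in> \<A>" "A \<noteq> zero_op" using ex_nonzero by blast
  then have "\<phi> (scale_op c A) = \<phi> (scale_op d A)" by (simp add: phi_scale eq)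
  then have "scale_op c A = scale_op d A" using A by (simp only: phi_eq_iff dom_closed)
  then show "c = d" using A(2) by (rule scale_op_cancel)
qed

lemma coeff_cnj: "coeff (cnj c) = cnj (coeff c)"
proof -
  obtain A where A: "A \<in> \<A>" "A \<noteq> zero_op" and sa: "cadjoint A = A" using ex_nonzero by blast
  have "scale_op (cnj c) A = cadjoint (scale_op c A)"
    by (simp add: cadjoint_scale_op dom_bounded A sa)
  then have "\<phi> (scale_op (cnj c) A) = cadjoint (\<phi> (scale_op c A))"
    using A phi_adj by simp
  also have "\<dots> = scale_op (cnj (coeff c)) (\<phi> A)"
    using A phi_adj[OF A(1)] by (simp add: phi_scale cadjoint_scale_op phi_bounded sa)
  finally show ?thesis by (rule coeff_eqI[OF A])
qed

section \<open>Matrix entries\<close>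

text \<open>
  The sum \<open>R\<close> of two orthogonal line projections is compared with the preimage \<open>S\<close> of the sum of
  their images. Each of the two dominates both lines, hence dominates the other one.
\<close>

lemma phi_add_orthogonal:
  assumes p: "norm p = 1" and q: "norm q = 1" and pq: "cinner p q = 0"
  shows "\<phi> (add_op (ketbra p p) (ketbra q q)) = add_op (\<phi> (ketbra p p)) (\<phi> (ketbra q q))"
proof -
  let ?P = "ketbra p p" and ?Q = "ketbra q q"
  let ?R = "add_op ?P ?Q"
  have add_zero: "add_op X zero_op = X" "add_op zero_op X = X" for X :: "'x \<Rightarrow> 'y::complex_vector"
    by (auto simp: add_op_apply)
  have PP: "jordan_product ?P ?P = ?P" "jordan_product ?Q ?Q = ?Q"
    using ketbra_self_idem p q by blast+
  have PQ: "jordan_product ?P ?Q = zero_op" "jordan_product ?Q ?P = zero_op"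
    using ketbra_self_orthogonal_iff[OF p q] pq jordan_product_commute[of ?Q ?P] by simp_all
  have R: "jordan_product ?R ?P = ?P" "jordan_product ?R ?Q = ?Q"
    by (simp_all add: jordan_product_add_left ketbra_bounded PP PQ add_zero)
  obtain S where S: "S \<in> \<A>" "\<phi> S = add_op (\<phi> ?P) (\<phi> ?Q)"
    using phi_surj[of "add_op (\<phi> ?P) (\<phi> ?Q)"] by auto
  have S': "jordan_product (\<phi> S) (\<phi> ?P) = \<phi> ?P" "jordan_product (\<phi> S) (\<phi> ?Q) = \<phi> ?Q"
    unfolding S(2)
    by (simp_all add: jordan_product_add_left phi_bounded phi_jp[symmetric] PP PQ add_zero phi_zero)
  have "jordan_product S ?P = ?P" "jordan_product S ?Q = ?Q"
    using phi_jp_iff[of S ?P ?P] phi_jp_iff[of S ?Q ?Q] S(1) S' by simp_all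
  then have SR: "jordan_product S ?R = ?R"
    by (simp add: jordan_product_add_right dom_bounded S)
  have "jordan_product (\<phi> ?R) (\<phi> S) = \<phi> S"
    unfolding S(2)
    by (simp add: jordan_product_add_right phi_bounded phi_jp[symmetric] R)
  then have "jordan_product ?R S = S"
    using phi_jp_iff[of ?R S S] S(1) by simp
  with SR have "?R = S" by (simp add: jordan_product_commute)
  with S show ?thesis by simp
qed

text \<open>
  The operator \<open>x y\<^sup>*\<close> is an eigenvector, with eigenvalue 1/2, of the Jordan multiplications by
  \<open>x x\<^sup>*\<close> and \<open>y y\<^sup>*\<close>. Its image is an eigenvector as well, and the only eigenvalue available for it
  is 1/2 again, because the factor by which \<open>\<phi>\<close> twists 1/2 is neither 0 nor 1.
\<close>

lemma phi_ketbra_orthogonal: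
  assumes x: "norm x = 1" and y: "norm y = 1" and xy: "cinner x y = 0"
    and u: "norm u = 1" "\<phi> (ketbra x x) = ketbra u u"
    and v: "norm v = 1" "\<phi> (ketbra y y) = ketbra v v"
  shows "coeff (1/2) = 1/2"
    and "\<exists>a. a \<noteq> 0 \<and> (\<phi> (ketbra x y) = scale_op a (ketbra u v) \<or>
      \<phi> (ketbra x y) = scale_op a (ketbra v u))"
proof -
  let ?T = "\<phi> (ketbra x y)"
  have uv: "cinner u v = 0"
    using orthogonal_iff[OF x y u(1) v(1) u(2) v(2)] xy by simp
  have T: "?T \<in> bounded_ops" by (simp add: phi_bounded)
  have nz: "?T \<noteq> zero_op"
    by (rule phi_nonzero[OF dom_closed(1) ketbra_nonzero[OF unit_nonzero[OF x] y]])
  have equ: "jordan_product ?T (ketbra u u) = scale_op (coeff (1/2)) ?T"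
    using phi_jp[of "ketbra x y" "ketbra x x"] ketbra_jordan_range[OF x xy] u(2)
    by (simp add: phi_scale)
  have eqv: "jordan_product ?T (ketbra v v) = scale_op (coeff (1/2)) ?T"
    using phi_jp[of "ketbra x y" "ketbra y y"] ketbra_jordan_support[OF y xy] v(2)
    by (simp add: phi_scale)
  have "coeff (1/2) \<noteq> coeff 0" "coeff (1/2) \<noteq> coeff 1"
    using coeff_inj[of "1/2" 0] coeff_inj[of "1/2" 1] by auto
  then show half: "coeff (1/2) = 1/2"
    using jordan_eigen_half(1)[OF u(1) T nz equ] by (simp add: coeff_zero coeff_one)
  have "jordan_product ?T ?T = zero_op"
    using phi_jp[of "ketbra x y" "ketbra x y"] jordan_square_zero[OF xy] by (simp add: phi_zero)
  then show "\<exists>a. a \<noteq> 0 \<and> (?T = scale_op a (ketbra u v) \<or> ?T = scale_op a (ketbra v u))"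
    using square_zero_two_half_eigen[OF u(1) v(1) uv T nz] equ eqv half by simp
qed

lemma coeff_half: "coeff (1/2) = 1/2"
proof -
  obtain x y :: 'h where xy: "norm x = 1" "norm y = 1" "cinner x y = 0" using dim by blast
  obtain u v where "norm u = 1" "\<phi> (ketbra x x) = ketbra u u" "norm v = 1" "\<phi> (ketbra y y) = ketbra v v"
    using image_ketbra_self xy by meson
  then show ?thesis using phi_ketbra_orthogonal(1)[OF xy] by blast
qed

lemma coeff_entry:
  assumes xy: "cinner x y = 0" and uv: "cinner u v = 0" and u: "norm u = 1" and v: "norm v = 1"
    and a: "a \<noteq> 0" and N: "\<phi> (ketbra x y) = scale_op a (ketbra u v)" and A: "A \<in> \<A>"
  shows "coeff (cinner (A x) y) = a * cinner (\<phi> A u) v"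
proof -
  let ?N = "ketbra x y" and ?M = "ketbra u v"
  have "scale_op (1/2 * coeff (cinner (A x) y)) (scale_op a ?M)
      = \<phi> (scale_op (1/2 * cinner (A x) y) ?N)"
    by (simp only: phi_scale[OF dom_closed(1)] coeff_mult coeff_half N)
  also have "\<dots> = \<phi> (jordan_product ?N (jordan_product A ?N))"
    by (simp only: jordan_sandwich[OF dom_bounded[OF A] xy])
  also have "\<dots> = jordan_product (scale_op a ?M) (jordan_product (\<phi> A) (scale_op a ?M))"
    using A by (simp add: phi_jp N)
  also have "\<dots> = scale_op a (scale_op a (jordan_product ?M (jordan_product (\<phi> A) ?M)))"
    using A by (simp add: jordan_product_scale_left jordan_product_scale_right ketbra_bounded
        phi_bounded cod_bounded)
  also have "\<dots> = scale_op (a * (1/2 * cinner (\<phi> A u) v)) (scale_op a ?M)"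
    using A by (simp add: jordan_sandwich[OF phi_bounded uv] scale_op_scale_op mult.commute mult.left_commute)
  finally have "1/2 * coeff (cinner (A x) y) = a * (1/2 * cinner (\<phi> A u) v)"
    by (rule scale_op_cancel) (intro scale_op_nonzero a ketbra_nonzero v unit_nonzero[OF u])
  then show ?thesis by simp
qed

text \<open>
  If the image of \<open>x y\<^sup>*\<close> is a multiple of \<open>v u\<^sup>*\<close>, then that of its adjoint \<open>y x\<^sup>*\<close> is a multiple of
  \<open>u v\<^sup>*\<close>; so each off-diagonal entry in the codomain is reached.
\<close>

lemma ex_coeff_entry:
  assumes u: "norm u = 1" and v: "norm v = 1" and uv: "cinner u v = 0"
  shows "\<exists>x y a. a \<noteq> 0 \<and> (\<forall>A\<in>\<A>. coeff (cinner (A x) y) = a * cinner (\<phi> A u) v)"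
proof -
  obtain x where x: "norm x = 1" "\<phi> (ketbra x x) = ketbra u u"
    using preimage_ketbra_self[OF u] by blast
  obtain y where y: "norm y = 1" "\<phi> (ketbra y y) = ketbra v v"
    using preimage_ketbra_self[OF v] by blast
  have xy: "cinner x y = 0" using orthogonal_iff[OF x(1) y(1) u v x(2) y(2)] uv by simp
  then have yx: "cinner y x = 0" by (simp add: cinner_zero_commute)
  obtain a where a: "a \<noteq> 0" and
    "\<phi> (ketbra x y) = scale_op a (ketbra u v) \<or> \<phi> (ketbra x y) = scale_op a (ketbra v u)"
    using phi_ketbra_orthogonal(2)[OF x(1) y(1) xy u x(2) v y(2)] by blast
  then show ?thesis
  proof (elim disjE)
    assume "\<phi> (ketbra x y) = scale_op a (ketbra u v)"
    then show ?thesis using coeff_entry[OF xy uv u v a] a by blast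
  next
    assume N: "\<phi> (ketbra x y) = scale_op a (ketbra v u)"
    have "\<phi> (ketbra y x) = scale_op (cnj a) (ketbra u v)"
      using phi_adj[of "ketbra x y"]
      by (simp add: cadjoint_ketbra N cadjoint_scale_op ketbra_bounded)
    then have "\<forall>A\<in>\<A>. coeff (cinner (A y) x) = cnj a * cinner (\<phi> A u) v"
      using coeff_entry[OF yx uv u v, of "cnj a"] a by simp
    then show ?thesis using a by (metis complex_cnj_zero_iff)
  qed
qed

section \<open>Additivity\<close>

text \<open>
  The projections \<open>P\<close> and \<open>Q\<close> onto the lines of \<open>x + y\<close> and \<open>x - y\<close> add up to a projection that is
  diagonal with respect to \<open>x\<close> and \<open>y\<close>, and the same is true of their images. Therefore the
  off-diagonal entry of \<open>P + t Q\<close> is proportional to \<open>1 - t\<close>, and that of its image, which is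
  \<open>\<phi> P + (f t) \<phi> Q\<close>, is proportional to \<open>1 - f t\<close>.
\<close>

lemma coeff_one_minus: "coeff (1 - t) = 1 - coeff t"
proof -
  obtain x y :: 'h where x: "norm x = 1" and y: "norm y = 1" and xy: "cinner x y = 0"
    using dim by blast
  have yx: "cinner y x = 0" using xy by (simp add: cinner_zero_commute)
  define h where "h = complex_of_real (1 / sqrt 2)"
  have hh: "h * cnj h = 1 / 2"
    unfolding h_def complex_cnj_complex_of_real of_real_mult[symmetric] by (simp del: of_real_mult)
  define p where "p = h *\<^sub>C (x + y)"
  define q where "q = h *\<^sub>C (x - y)"
  have p: "norm p = 1" and q: "norm q = 1" and pq: "cinner p q = 0"
    using half_sum_unit[OF x y xy] by (simp_all add: p_def q_def h_def)
  have qp: "cinner q p = 0" using pq by (simp add: cinner_zero_commute)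
  let ?P = "ketbra p p" and ?Q = "ketbra q q"
  obtain u where u: "norm u = 1" "\<phi> (ketbra x x) = ketbra u u" using image_ketbra_self[OF x] by blast
  obtain v where v: "norm v = 1" "\<phi> (ketbra y y) = ketbra v v" using image_ketbra_self[OF y] by blast
  have uv: "cinner u v = 0" using orthogonal_iff[OF x y u(1) v(1) u(2) v(2)] xy by simp
  then have vu: "cinner v u = 0" by (simp add: cinner_zero_commute)
  have sum: "add_op (\<phi> ?P) (\<phi> ?Q) = add_op (ketbra u u) (ketbra v v)"
    using phi_add_orthogonal[OF p q pq] phi_add_orthogonal[OF x y xy] u(2) v(2)
      resolution_ketbra[of x y] by (simp add: p_def q_def h_def)
  obtain a u' v' where a: "a \<noteq> 0" and N: "\<phi> (ketbra x y) = scale_op a (ketbra u' v')"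
    and uv': "u' = u \<and> v' = v \<or> u' = v \<and> v' = u"
    using phi_ketbra_orthogonal(2)[OF x y xy u v] by blast
  have o': "norm u' = 1" "norm v' = 1" "cinner u' v' = 0"
    using uv' u v uv vu by auto
  \<comment> \<open>The sum of the two images is diagonal with respect to \<open>u\<close> and \<open>v\<close>.\<close>
  have sum0: "cinner (\<phi> ?P u') v' + cinner (\<phi> ?Q u') v' = 0"
    using arg_cong[OF fun_cong[OF sum, of u'], of "\<lambda>w. cinner w v'"] uv' uv vu
    by (auto simp: add_op_apply cinner_simps ketbra_apply)
  have main: "coeff (1/2 * (1 - t)) = a * cinner (\<phi> ?P u') v' * (1 - coeff t)" for t
  proof -
    let ?A = "add_op ?P (scale_op t ?Q)"
    have A: "?A \<in> \<A>" by simp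
    have PQ: "jordan_product ?P ?Q = zero_op" "jordan_product ?Q ?P = zero_op"
      using ketbra_self_orthogonal_iff p q pq qp by blast+
    have add0: "add_op Z zero_op = Z" "add_op zero_op Z = Z" "scale_op c zero_op = zero_op"
      for Z :: "'x \<Rightarrow> 'y::complex_vector" and c
      by (auto simp: add_op_apply scale_op_apply)
    have AP: "jordan_product ?A ?P = ?P" "jordan_product ?A ?Q = scale_op t ?Q"
      by (simp_all add: jordan_product_add_left jordan_product_scale_left ketbra_bounded
          ketbra_self_idem p q PQ add0)
    then have "jordan_product ?A (add_op ?P ?Q) = ?A"
      by (simp add: jordan_product_add_right dom_bounded[OF A])
    then have "\<phi> ?A = jordan_product (\<phi> ?A) (add_op (\<phi> ?P) (\<phi> ?Q))"
      using phi_jp[OF A, of "add_op ?P ?Q"] phi_add_orthogonal[OF p q pq] by simp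
    also have "\<dots> = add_op (\<phi> ?P) (scale_op (coeff t) (\<phi> ?Q))"
      by (simp add: jordan_product_add_right phi_bounded A phi_jp[symmetric] AP phi_scale)
    finally have phiA: "\<phi> ?A = add_op (\<phi> ?P) (scale_op (coeff t) (\<phi> ?Q))" .
    have "cinner (?A x) y = (h * cnj h) * (1 - t)"
      by (simp add: add_op_apply scale_op_apply ketbra_apply p_def q_def cinner_simps
          cinner_self_unit x y xy yx algebra_simps)
    then have "coeff (1/2 * (1 - t)) = coeff (cinner (?A x) y)"
      unfolding hh by (simp only:)
    also have "\<dots> = a * cinner (\<phi> ?A u') v'"
      by (rule coeff_entry[OF xy o'(3,1,2) a N A])
    also have "cinner (\<phi> ?A u') v' = cinner (\<phi> ?P u') v' * (1 - coeff t)"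
      using sum0 by (simp add: phiA add_op_apply scale_op_apply cinner_simps algebra_simps
          add_eq_0_iff2)
    finally show ?thesis by simp
  qed
  \<comment> \<open>The case \<open>t = 0\<close> determines the factor.\<close>
  from main[of 0] have "a * cinner (\<phi> ?P u') v' = 1/2"
    by (simp add: coeff_half coeff_zero)
  with main[of t] show ?thesis
    by (simp only: coeff_mult coeff_half) simp
qed

lemma coeff_minus: "coeff (- c) = - coeff c"
proof -
  have "coeff (-1) * coeff (-1) = 1" using coeff_mult[of "-1" "-1"] by (simp add: coeff_one)
  then have "coeff (-1) = 1 \<or> coeff (-1) = -1" using square_eq_1_iff by blast
  moreover have "coeff (-1) \<noteq> 1" using coeff_inj[of "-1" 1] by (auto simp: coeff_one)
  ultimately show ?thesis using coeff_mult[of "-1" c] by simp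
qed

text \<open>
  Writing \<open>c + d = c (1 - (- d / c))\<close> turns a sum into products and the map \<open>t \<mapsto> 1 - t\<close>.
\<close>

lemma coeff_add: "coeff (c + d) = coeff c + coeff d"
proof (cases "c = 0")
  case False
  then have "coeff (c + d) = coeff (c * (1 - (- (d / c))))" by (simp add: distrib_left)
  also have "\<dots> = coeff c * (1 + coeff (d / c))"
    by (simp only: coeff_mult coeff_one_minus coeff_minus) simp
  also have "\<dots> = coeff c + coeff (c * (d / c))"
    by (simp only: coeff_mult distrib_left mult_1_right)
  finally show ?thesis using False by simp
qed (simp add: coeff_zero)

lemma coeff_cases: "(\<forall>z. coeff z = z) \<or> (\<forall>z. coeff z = cnj z)"
  by (rule complex_ring_endo_cases) (rule coeff_add coeff_mult coeff_one coeff_cnj)+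

lemma coeff_of_real: "coeff (of_real r) = of_real r"
  using coeff_cases by auto

lemma coeff_surj: "\<exists>c. coeff c = d"
  using coeff_cases by (metis complex_cnj_cnj)

lemma cod_orthonormal_pair: "\<exists>u v :: 'k. norm u = 1 \<and> norm v = 1 \<and> cinner u v = 0"
proof -
  obtain x y :: 'h where x: "norm x = 1" and y: "norm y = 1" and xy: "cinner x y = 0"
    using dim by blast
  obtain u where u: "norm u = 1" "\<phi> (ketbra x x) = ketbra u u" using image_ketbra_self[OF x] by blast
  obtain v where v: "norm v = 1" "\<phi> (ketbra y y) = ketbra v v" using image_ketbra_self[OF y] by blast
  have "cinner u v = 0" using orthogonal_iff[OF x y u(1) v(1) u(2) v(2)] xy by simp
  with u v show ?thesis by blast
qed

text \<open>
  The off-diagonal entries of \<open>\<phi> A\<close> depend additively on \<open>A\<close>, for all \<open>A\<close> of the algebra.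
  Using this for \<open>A \<circ> P\<close> as well, where \<open>P\<close> is a line projection, covers the diagonal.
\<close>

lemma phi_add:
  assumes A: "A \<in> \<A>" and B: "B \<in> \<A>"
  shows "\<phi> (add_op A B) = add_op (\<phi> A) (\<phi> B)"
proof -
  have off: "cinner (\<phi> (add_op A B) u) v = cinner (add_op (\<phi> A) (\<phi> B) u) v"
    if AB: "A \<in> \<A>" "B \<in> \<A>" and uv: "norm u = 1" "norm v = 1" "cinner u v = 0" for A B u v
  proof -
    obtain x y a where a: "a \<noteq> 0"
      and entry: "\<And>A. A \<in> \<A> \<Longrightarrow> coeff (cinner (A x) y) = a * cinner (\<phi> A u) v"
      using ex_coeff_entry[OF uv] by blast
    have "a * cinner (\<phi> (add_op A B) u) v = coeff (cinner (A x) y + cinner (B x) y)"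
      using entry[of "add_op A B"] AB by (simp add: add_op_apply cinner_simps)
    also have "\<dots> = a * cinner (add_op (\<phi> A) (\<phi> B) u) v"
      by (simp add: coeff_add entry AB add_op_apply cinner_simps algebra_simps)
    finally show ?thesis using a by simp
  qed
  show ?thesis
  proof (rule op_eqI_offdiagonal[OF _ _ cod_orthonormal_pair])
    fix e u v :: 'k assume e: "norm e = 1" and uv: "norm u = 1" "norm v = 1" "cinner u v = 0"
    obtain p where p: "\<phi> (ketbra p p) = ketbra e e" using preimage_ketbra_self[OF e] by blast
    have "jordan_product (\<phi> (add_op A B)) (ketbra e e)
        = \<phi> (add_op (jordan_product A (ketbra p p)) (jordan_product B (ketbra p p)))"
      using A B by (simp add: p[symmetric] phi_jp[symmetric] jordan_product_add_left ketbra_bounded)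
    moreover have "jordan_product (add_op (\<phi> A) (\<phi> B)) (ketbra e e)
        = add_op (\<phi> (jordan_product A (ketbra p p))) (\<phi> (jordan_product B (ketbra p p)))"
      using A B by (simp add: p phi_jp jordan_product_add_left ketbra_bounded)
    ultimately show "cinner (jordan_product (\<phi> (add_op A B)) (ketbra e e) u) v =
        cinner (jordan_product (add_op (\<phi> A) (\<phi> B)) (ketbra e e) u) v"
      using off[OF _ _ uv] A B by simp
  qed (use off A B cod_bounded in simp_all)
qed

section \<open>Construction of the implementing operator\<close>

text \<open>
  One operator \<open>x\<^sub>0 e\<^sup>*\<close> whose image has \<open>e'\<close> on the right decides the position of \<open>e'\<close> for all the
  others, because \<open>x e\<^sup>* \<circ> y e\<^sup>* = 0\<close> if \<open>x\<close> and \<open>y\<close> are orthogonal to \<open>e\<close>, whereas \<open>u e'\<^sup>* \<circ> e' v\<^sup>*\<close> is nonzero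
  for nonzero \<open>u\<close> and \<open>v\<close> orthogonal to \<open>e'\<close>. The map \<open>U\<close> so obtained is isometric up to \<open>f\<close>, by
  comparing the images of both sides of \<open>x e\<^sup>* \<circ> e y\<^sup>* = (x y\<^sup>* + \<langle>x, y\<rangle> e e\<^sup>*) / 2\<close> for \<open>x\<close> and \<open>y\<close>
  orthogonal to \<open>e\<close>: there \<open>x y\<^sup>* \<circ> e e\<^sup>* = 0\<close>, so the image of \<open>x y\<^sup>*\<close> has no component in direction \<open>e' e'\<^sup>*\<close>.
\<close>

lemma implemented_by_semilinear:
  assumes e: "norm e = 1" and x0: "norm x0 = 1" "cinner x0 e = 0"
    and e': "norm e' = 1" "\<phi> (ketbra e e) = ketbra e' e'"
    and u0: "norm u0 = 1" "cinner u0 e' = 0"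
    and a0: "a0 \<noteq> 0" "\<phi> (ketbra x0 e) = scale_op a0 (ketbra u0 e')"
  shows "\<exists>U :: 'h \<Rightarrow> 'k. (\<forall>x y. U (x + y) = U x + U y) \<and> (\<forall>c x. U (c *\<^sub>C x) = coeff c *\<^sub>C U x) \<and>
    (\<forall>x. norm (U x) = norm x) \<and> surj U \<and> (\<forall>A\<in>\<A>. \<forall>x. \<phi> A (U x) = U (A x))"
proof -
  have perp: "\<exists>b. b \<noteq> 0 \<and> cinner u e' = 0 \<and> \<phi> (ketbra x e) = scale_op b (ketbra u e')"
    if x: "norm x = 1" "cinner x e = 0" and u: "norm u = 1" "\<phi> (ketbra x x) = ketbra u u" for x u
  proof -
    have ue: "cinner u e' = 0" using orthogonal_iff[OF x(1) e u(1) e'(1) u(2) e'(2)] x(2) by simp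
    obtain b where b: "b \<noteq> 0" and
      or: "\<phi> (ketbra x e) = scale_op b (ketbra u e') \<or> \<phi> (ketbra x e) = scale_op b (ketbra e' u)"
      using phi_ketbra_orthogonal(2)[OF x(1) e x(2) u e'] by blast
    have "\<phi> (ketbra x e) \<noteq> scale_op b (ketbra e' u)"
    proof
      assume *: "\<phi> (ketbra x e) = scale_op b (ketbra e' u)"
      have "jordan_product (ketbra x0 e) (ketbra x e) = zero_op"
        by (rule jordan_product_eqI) (simp add: ketbra_apply x x0 cinner_simps)
      then have "jordan_product (scale_op a0 (ketbra u0 e')) (scale_op b (ketbra e' u)) = zero_op"
        using phi_jp[of "ketbra x0 e" "ketbra x e"] by (simp add: a0 * phi_zero)
      from jordan_product_eqD[OF this, of u] have "(a0 * b) *\<^sub>C u0 = 0"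
        by (simp add: scale_op_apply ketbra_apply cinner_simps cinner_self_unit u e' ue
            scaleC_scaleC scaleC_one)
      then show False using a0 b unit_nonzero[OF u0(1)] by simp
    qed
    with b or ue show ?thesis by blast
  qed
  define U where "U x = \<phi> (ketbra x e) e'" for x
  have U_add: "U (x + y) = U x + U y" for x y
    by (simp add: U_def ketbra_add_left phi_add add_op_apply)
  have U_scale: "U (c *\<^sub>C x) = coeff c *\<^sub>C U x" for c x
    by (simp add: U_def ketbra_scale_left phi_scale scale_op_apply)
  have Ue: "U e = e'" by (simp add: U_def e' ketbra_apply cinner_self_unit scaleC_one)
  \<comment> \<open>A vector orthogonal to \<open>e\<close> is a multiple of a unit vector, for which the form of the image
    is known.\<close>
  have U_perp: "\<phi> (ketbra w e) = ketbra (U w) e' \<and> cinner (U w) e' = 0" if w: "cinner w e = 0" for w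
  proof (cases "w = 0")
    case True
    then show ?thesis by (simp add: U_def phi_zero ketbra_zero_left)
  next
    case False
    define c where "c = complex_of_real (norm w)"
    define x where "x = complex_of_real (1 / norm w) *\<^sub>C w"
    have x: "norm x = 1" "cinner x e = 0" and wx: "w = c *\<^sub>C x"
      using unit_scale[OF False] w by (auto simp: x_def c_def cinner_scaleC_left)
    obtain u where u: "norm u = 1" "\<phi> (ketbra x x) = ketbra u u" using image_ketbra_self[OF x(1)] by blast
    obtain b where ue: "cinner u e' = 0" and b: "\<phi> (ketbra x e) = scale_op b (ketbra u e')"
      using perp[OF x u] by blast
    have Ux: "U x = b *\<^sub>C u"
      by (simp add: U_def b scale_op_apply ketbra_apply cinner_self_unit e' scaleC_one)
    show ?thesis
      by (simp add: wx U_scale Ux ketbra_scale_left phi_scale b cinner_simps ue scale_op_scale_op)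
  qed
  have phi_left: "\<phi> (ketbra x e) = ketbra (U x) e'" for x
  proof -
    obtain w where w: "x = cinner x e *\<^sub>C e + w" "cinner w e = 0"
      using orthogonal_decomposition[OF e] by blast
    show ?thesis
      by (subst w(1), subst (2) w(1))
        (simp add: ketbra_add_left ketbra_scale_left phi_add phi_scale U_add U_scale Ue e' U_perp[OF w(2)])
  qed
  have phi_right: "\<phi> (ketbra e y) = ketbra e' (U y)" for y
    using phi_adj[of "ketbra y e"] by (simp add: cadjoint_ketbra phi_left)
  have phi_ketbra: "\<phi> (ketbra x y) z + (coeff (cinner x y) * cinner z e') *\<^sub>C e' =
    cinner z (U y) *\<^sub>C U x + (cinner (U x) (U y) * cinner z e') *\<^sub>C e'" for x y z
  proof -
    have "scale_op (1/2) (add_op (\<phi> (ketbra x y)) (scale_op (coeff (cinner x y)) (ketbra e' e')))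
        = \<phi> (jordan_product (ketbra x e) (ketbra e y))"
      by (simp add: ketbra_through_unit[OF e] phi_scale phi_add e' coeff_half)
    also have "\<dots> = scale_op (1/2)
        (add_op (ketbra (U x) (U y)) (scale_op (cinner (U x) (U y)) (ketbra e' e')))"
      by (simp add: phi_jp phi_left phi_right ketbra_through_unit e')
    finally show ?thesis
      by (auto dest!: fun_cong[of _ _ z] simp: scale_op_apply add_op_apply ketbra_apply scaleC_scaleC)
  qed
  have cinner_perp: "cinner (U x) (U y) = coeff (cinner x y)"
    if x: "cinner x e = 0" and y: "cinner y e = 0" for x y
  proof -
    have "jordan_product (ketbra x y) (ketbra e e) = zero_op"
      using y by (intro jordan_product_eqI) (simp add: ketbra_apply cinner_simps x cinner_zero_commute)
    then have jp: "jordan_product (\<phi> (ketbra x y)) (ketbra e' e') = zero_op"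
      using phi_jp[of "ketbra x y" "ketbra e e"] by (simp add: e' phi_zero)
    define k where "k = cinner (U x) (U y) - coeff (cinner x y)"
    have "cinner e' (U y) = 0" using U_perp[OF y] by (simp add: cinner_zero_commute)
    then have "\<phi> (ketbra x y) e' = k *\<^sub>C e'"
      using phi_ketbra[of x y e'] by (simp add: k_def cinner_self_unit e' scaleC_simps eq_diff_eq)
    then have "(2 * k) *\<^sub>C e' = 0"
      using jordan_product_eqD[OF jp, of e']
      by (simp add: ketbra_apply cinner_self_unit e' scaleC_one cinner_simps flip: scaleC_two)
    then have "k = 0" using unit_nonzero[OF e'(1)] by simp
    then show ?thesis by (simp add: k_def)
  qed
  have cinner_U: "cinner (U x) (U y) = coeff (cinner x y)" for x y
  proof -
    obtain w where w: "x = cinner x e *\<^sub>C e + w" "cinner w e = 0"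
      using orthogonal_decomposition[OF e] by blast
    obtain v where v: "y = cinner y e *\<^sub>C e + v" "cinner v e = 0"
      using orthogonal_decomposition[OF e] by blast
    have ev: "cinner e v = 0" "cinner e' (U v) = 0"
      using v(2) U_perp[OF v(2)] by (simp_all add: cinner_zero_commute)
    have "cinner (U x) (U y) = coeff (cinner x e) * cnj (coeff (cinner y e)) + coeff (cinner w v)"
      by (subst w(1), subst v(1)) (simp add: U_add U_scale Ue cinner_simps cinner_self_unit e'
          U_perp[OF w(2)] ev cinner_perp[OF w(2) v(2)])
    moreover have "cinner x y = cinner x e * cnj (cinner y e) + cinner w v"
      by (subst w(1), subst v(1)) (simp add: cinner_simps cinner_self_unit e w(2) ev)
    ultimately show ?thesis by (simp add: coeff_add coeff_mult coeff_cnj)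
  qed
  have phi_ketbra: "\<phi> (ketbra x y) = ketbra (U x) (U y)" for x y
    using phi_ketbra by (auto simp: cinner_U ketbra_apply)
  have norm_U: "norm (U x) = norm x" for x
  proof -
    have "cinner (U x) (U x) = cinner x x"
      unfolding cinner_U unfolding cinner_self_norm coeff_of_real ..
    then show ?thesis by (simp add: norm_eq_sqrt_cinner)
  qed
  have "surj U"
  proof -
    have perp_range: "w \<in> range U" if w: "cinner w e' = 0" for w
    proof (cases "w = 0")
      case True
      moreover have "U 0 = 0" using U_add[of 0 0] by simp
      ultimately show ?thesis by (metis rangeI)
    next
      case False
      define v where "v = complex_of_real (1 / norm w) *\<^sub>C w"
      have v: "norm v = 1" "cinner v e' = 0" and wv: "w = complex_of_real (norm w) *\<^sub>C v"
        using unit_scale[OF False] w by (auto simp: v_def cinner_scaleC_left)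
      obtain x where x: "norm x = 1" "\<phi> (ketbra x x) = ketbra v v"
        using preimage_ketbra_self[OF v(1)] by blast
      have xe: "cinner x e = 0"
        using orthogonal_iff[OF x(1) e v(1) e'(1) x(2) e'(2)] v(2) by simp
      obtain b where b: "b \<noteq> 0" "\<phi> (ketbra x e) = scale_op b (ketbra v e')"
        using perp[OF x(1) xe v(1) x(2)] by blast
      obtain c where "coeff c = complex_of_real (norm w) / b" using coeff_surj by blast
      then have "U (c *\<^sub>C x) = complex_of_real (norm w) *\<^sub>C v"
        unfolding U_scale using b
        by (simp add: U_def scale_op_apply ketbra_apply cinner_self_unit e' scaleC_one scaleC_scaleC)
      with wv show ?thesis by (metis rangeI)
    qed
    have "y \<in> range U" for y
    proof -
      obtain w where w: "y = cinner y e' *\<^sub>C e' + w" "cinner w e' = 0"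
        using orthogonal_decomposition[OF e'(1)] by blast
      obtain z where z: "w = U z" using perp_range[OF w(2)] by blast
      obtain d where "coeff d = cinner y e'" using coeff_surj by blast
      then have "U (d *\<^sub>C e + z) = cinner y e' *\<^sub>C e' + w"
        by (simp add: U_add U_scale Ue z)
      with w(1) show ?thesis by (metis rangeI)
    qed
    then show ?thesis by blast
  qed
  \<comment> \<open>Jordan multiplication by the line projection of \<open>x\<close> reduces a general \<open>A\<close> to rank-one
    operators, whose images are known by now.\<close>
  have intertwine_unit: "\<phi> A (U x) = U (A x)" if A: "A \<in> \<A>" and x: "norm x = 1" for A x
  proof -
    have Ux: "cinner (U x) (U x) = 1" by (simp add: cinner_U cinner_self_unit x coeff_one)
    have adj: "cinner (U x) (U (cadjoint A x)) = cinner (U (A x)) (U x)"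
      by (simp add: cinner_U cinner_cadjoint[OF dom_bounded[OF A]])
    have "jordan_product (\<phi> A) (ketbra (U x) (U x)) = \<phi> (jordan_product A (ketbra x x))"
      using A by (simp add: phi_jp phi_ketbra)
    also have "\<dots> = scale_op (1/2)
        (add_op (ketbra (U (A x)) (U x)) (ketbra (U x) (U (cadjoint A x))))"
      by (simp add: jordan_product_ketbra_self[OF dom_bounded[OF A]] phi_scale phi_add phi_ketbra
          coeff_half)
    finally have "\<phi> A (U x) + cinner (\<phi> A (U x)) (U x) *\<^sub>C U x
        = U (A x) + cinner (U (A x)) (U x) *\<^sub>C U x"
      using jordan_product_eqD[of "\<phi> A" "ketbra (U x) (U x)" _ "U x"]
      by (simp add: ketbra_apply add_op_apply scale_op_apply Ux adj scaleC_one)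
    moreover from arg_cong[OF this, of "\<lambda>v. cinner v (U x)"]
    have "cinner (\<phi> A (U x)) (U x) = cinner (U (A x)) (U x)"
      by (simp add: cinner_simps Ux)
    ultimately show ?thesis by simp
  qed
  have intertwine: "\<phi> A (U x) = U (A x)" if A: "A \<in> \<A>" for A x
  proof (cases "x = 0")
    case True
    have "U 0 = 0" using U_add[of 0 0] by simp
    then show ?thesis
      by (simp add: True bounded_ops_zero[OF phi_bounded[OF A]] bounded_ops_zero[OF dom_bounded[OF A]])
  next
    case False
    define y where "y = complex_of_real (1 / norm x) *\<^sub>C x"
    have y: "norm y = 1" "x = complex_of_real (norm x) *\<^sub>C y"
      using unit_scale[OF False] by (auto simp: y_def)
    show ?thesis
      by (subst (1 2) y(2))
        (simp only: U_scale bounded_ops_scale[OF phi_bounded[OF A]] bounded_ops_scale[OF dom_bounded[OF A]]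
          intertwine_unit[OF A y(1)])
  qed
  show ?thesis
    using U_add U_scale norm_U \<open>surj U\<close> intertwine by blast
qed

lemma implemented_by_unitary_or_antiunitary:
  assumes "norm e = 1" "norm x0 = 1" "cinner x0 e = 0"
    and "norm e' = 1" "\<phi> (ketbra e e) = ketbra e' e'"
    and "norm u0 = 1" "cinner u0 e' = 0"
    and "a0 \<noteq> 0" "\<phi> (ketbra x0 e) = scale_op a0 (ketbra u0 e')"
  shows "(\<exists>U :: 'h \<Rightarrow> 'k. unitary U \<and> (\<forall>A\<in>\<A>. \<phi> A = U \<circ> A \<circ> cadjoint U)) \<or>
         (\<exists>U :: 'h \<Rightarrow> 'k. antiunitary U \<and> (\<forall>A\<in>\<A>. \<phi> A = U \<circ> A \<circ> conj_adjoint U))"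
proof -
  obtain U :: "'h \<Rightarrow> 'k" where U: "\<And>x y. U (x + y) = U x + U y"
      "\<And>c x. U (c *\<^sub>C x) = coeff c *\<^sub>C U x" "\<And>x. norm (U x) = norm x" "surj U"
    and inter: "\<And>A x. A \<in> \<A> \<Longrightarrow> \<phi> A (U x) = U (A x)"
    using implemented_by_semilinear[OF assms] by blast
  have inv: "\<phi> A = U \<circ> A \<circ> inv U" if "A \<in> \<A>" for A
  proof
    fix z
    show "\<phi> A z = (U \<circ> A \<circ> inv U) z"
      using inter[OF that, of "inv U z"] by (simp add: surj_f_inv_f[OF U(4)])
  qed
  from coeff_cases show ?thesis
  proof
    assume "\<forall>z. coeff z = z"
    then have "unitary U"
      by (simp add: unitary_def Vector_Spaces.linear_iff U complex_vector.vector_space_axioms)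
    moreover from this have "\<forall>A\<in>\<A>. \<phi> A = U \<circ> A \<circ> cadjoint U"
      by (simp add: unitary_cadjoint inv)
    ultimately show ?thesis by blast
  next
    assume "\<forall>z. coeff z = cnj z"
    then have "antiunitary U"
      by (simp add: antiunitary_def conj_linear_def U)
    moreover from this have "\<forall>A\<in>\<A>. \<phi> A = U \<circ> A \<circ> conj_adjoint U"
      by (simp add: antiunitary_conj_adjoint inv)
    ultimately show ?thesis by blast
  qed
qed

text \<open>
  The passage to this map exchanges the two possible forms of the images of the \<open>x e\<^sup>*\<close>.
\<close>

lemma jordan_star_iso_cadjoint: "jordan_star_iso \<A> \<B> (\<lambda>A. \<phi> (cadjoint A))"
proof
  show "bij_betw (\<lambda>A. \<phi> (cadjoint A)) \<A> \<B>"
  proof (rule bij_betw_trans[OF _ bij, of cadjoint, unfolded comp_def])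
    show "bij_betw cadjoint \<A> \<A>"
      by (rule bij_betw_byWitness[of _ cadjoint])
        (auto simp: cadjoint_cadjoint dom_bounded)
  qed
  show "\<phi> (cadjoint (cadjoint A)) = cadjoint (\<phi> (cadjoint A))" if "A \<in> \<A>" for A
    using that by (simp only: phi_adj[OF adj_dom])
  show "\<phi> (cadjoint (jordan_product A B)) = jordan_product (\<phi> (cadjoint A)) (\<phi> (cadjoint B))"
    if "A \<in> \<A>" "B \<in> \<A>" for A B
    using that by (simp add: cadjoint_jordan_product dom_bounded phi_jp)
qed (rule dim soa_dom adj_dom soa_cod | assumption)+

end

theorem corollary2:
  fixes \<A> :: "('h::complex_hilbert_space \<Rightarrow> 'h) set"
    and \<B> :: "('k::complex_hilbert_space \<Rightarrow> 'k) set"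
    and \<phi> :: "('h \<Rightarrow> 'h) \<Rightarrow> ('k \<Rightarrow> 'k)"
  assumes "cdim_greater TYPE('h) 1"
    and "standard_operator_algebra \<A>" and "\<And>A. A \<in> \<A> \<Longrightarrow> cadjoint A \<in> \<A>"
    and "standard_operator_algebra \<B>" and "\<And>B. B \<in> \<B> \<Longrightarrow> cadjoint B \<in> \<B>"
    and "bij_betw \<phi> \<A> \<B>"
    and "\<And>A. A \<in> \<A> \<Longrightarrow> \<phi> (cadjoint A) = cadjoint (\<phi> A)"
    and "\<And>A B. A \<in> \<A> \<Longrightarrow> B \<in> \<A> \<Longrightarrow>
           \<phi> (jordan_product A B) = jordan_product (\<phi> A) (\<phi> B)"
  shows "(\<exists>U :: 'h \<Rightarrow> 'k. unitary U \<and> (\<forall>A\<in>\<A>. \<phi> A = U \<circ> A \<circ> cadjoint U)) \<or>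
         (\<exists>U :: 'h \<Rightarrow> 'k. antiunitary U \<and> (\<forall>A\<in>\<A>. \<phi> A = U \<circ> A \<circ> conj_adjoint U)) \<or>
         (\<exists>U :: 'h \<Rightarrow> 'k. unitary U \<and> (\<forall>A\<in>\<A>. \<phi> A = U \<circ> cadjoint A \<circ> cadjoint U)) \<or>
         (\<exists>U :: 'h \<Rightarrow> 'k. antiunitary U \<and> (\<forall>A\<in>\<A>. \<phi> A = U \<circ> cadjoint A \<circ> conj_adjoint U))"
proof -
  interpret \<phi>: jordan_star_iso \<A> \<B> \<phi>
    by unfold_locales (rule orthonormal_pair_of_cdim_greater_1 assms | assumption)+
  interpret adj: jordan_star_iso \<A> \<B> "\<lambda>A. \<phi> (cadjoint A)"
    by (rule \<phi>.jordan_star_iso_cadjoint)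
  obtain x e :: 'h where x: "norm x = 1" and e: "norm e = 1" and xe: "cinner x e = 0"
    using \<phi>.dim by blast
  obtain u where u: "norm u = 1" "\<phi> (ketbra x x) = ketbra u u"
    using \<phi>.image_ketbra_self[OF x] by blast
  obtain e' where e': "norm e' = 1" "\<phi> (ketbra e e) = ketbra e' e'"
    using \<phi>.image_ketbra_self[OF e] by blast
  have ue: "cinner u e' = 0"
    using \<phi>.orthogonal_iff[OF x e u(1) e'(1) u(2) e'(2)] xe by simp
  obtain a where a: "a \<noteq> 0" and
    "\<phi> (ketbra x e) = scale_op a (ketbra u e') \<or> \<phi> (ketbra x e) = scale_op a (ketbra e' u)"
    using \<phi>.phi_ketbra_orthogonal(2)[OF x e xe u e'] by blast
  then show ?thesis
  proof (elim disjE)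
    assume "\<phi> (ketbra x e) = scale_op a (ketbra u e')"
    from \<phi>.implemented_by_unitary_or_antiunitary[OF e x xe e' u(1) ue a this]
    show ?thesis by blast
  next
    assume N: "\<phi> (ketbra x e) = scale_op a (ketbra e' u)"
    have "\<phi> (cadjoint (ketbra x e)) = scale_op (cnj a) (ketbra u e')"
      using \<phi>.phi_adj[of "ketbra x e"]
      by (simp add: N cadjoint_scale_op ketbra_bounded cadjoint_ketbra)
    moreover have "\<phi> (cadjoint (ketbra e e)) = ketbra e' e'"
      by (simp add: cadjoint_ketbra e')
    moreover have "cnj a \<noteq> 0" using a by simp
    ultimately have adj: "(\<exists>U :: 'h \<Rightarrow> 'k. unitary U \<and> (\<forall>A\<in>\<A>. \<phi> (cadjoint A) = U \<circ> A \<circ> cadjoint U)) \<or>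
         (\<exists>U :: 'h \<Rightarrow> 'k. antiunitary U \<and> (\<forall>A\<in>\<A>. \<phi> (cadjoint A) = U \<circ> A \<circ> conj_adjoint U))"
      using adj.implemented_by_unitary_or_antiunitary[OF e x xe e'(1) _ u(1) ue] by blast
    have "\<phi> A = U \<circ> cadjoint A \<circ> V"
      if "\<forall>A\<in>\<A>. \<phi> (cadjoint A) = U \<circ> A \<circ> V" "A \<in> \<A>" for U :: "'h \<Rightarrow> 'k" and V A
      using that(1)[rule_format, of "cadjoint A"] that(2)
      by (simp add: assms(3) cadjoint_cadjoint[OF \<phi>.dom_bounded])
    with adj show ?thesis by blast
  qed
qed

end
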